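(* Let $Y$ be a diagonal doubly-resonant saddle-node (with eigenvalues $0,-\lambda,\lambda$, $\lambda\in\mathbb{C}^*$) which is strictly non-degenerate and div-integrable, with formal normal form $Y_{\mathrm{norm}}$, and let $\Phi_+$, $\Phi_-$ be the sectorial normalizing maps of $Y$ (the weak 1-sums of the formal normalizing map $\hat\Phi$ of $Y$ in the directions $\arg(i\lambda)$ and $\arg(-i\lambda)$). Let $\varphi_+$ and $\varphi_-$ be two germs of sectorial fibered diffeomorphisms in $S_+\times(\mathbb{C}^2,0)$ and $S_-\times(\mathbb{C}^2,0)$ respectively, where $$S_\pm=\Big\{x\in\mathbb{C}\;\Big|\;0<|x|<r,\ \Big|\arg\Big(\frac{\pm x}{i\lambda}\Big)\Big|<\frac{\pi}{2}+\epsilon\Big\},\qquad \epsilon\in\left]0,\tfrac{\pi}{2}\right[,\ r>0\text{ small enough},$$ which are (asymptotically) tangent to the identity and such that $(\varphi_\pm)_*(Y)=Y_{\mathrm{norm}}$. Then $\varphi_+$ and $\varphi_-$ necessarily coincide (as germs) with $\Phi_+$ and $\Phi_-$ respectively.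
   Context: Coordinates on $\mathbb{C}^3$ are $(x,\mathbf{y})=(x,y_1,y_2)$; $(\mathbb{C}^n,0)$ denotes an arbitrarily small open neighborhood of the origin. **Vector fields.** A diagonal doubly-resonant saddle-node is a germ of analytic vector field at $0\in\mathbb{C}^3$ of the form $Y=x^2\partial_x+(-\lambda y_1+F_1(x,\mathbf{y}))\partial_{y_1}+(\lambda y_2+F_2(x,\mathbf{y}))\partial_{y_2}$ with $\lambda\in\mathbb{C}^*$ and $F_1,F_2\in\mathbb{C}\{x,\mathbf{y}\}$ of order at least two. Write $(-\lambda y_1+F_1,\lambda y_2+F_2)^T=\alpha(x)+\mathbf{A}(x)\mathbf{y}+O(\|\mathbf{y}\|^2)$; the residue is $\operatorname{res}(Y):=\big(\operatorname{Tr}(\mathbf{A}(x))/x\big)_{|x=0}$. $Y$ is strictly non-degenerate if $\Re(\operatorname{res}(Y))>0$. $Y$ is div-integrable if $Y_{|\{x=0\}}$ is analytically conjugate, near $0\in\mathbb{C}^2$, to some $U(\mathbf{y})(\lambda_1y_1\partial_{y_1}+\lambda_2y_2\partial_{y_2})$ with $U\in\mathbb{C}\{\mathbf{y}\}$, $U(0)\neq0$, $(\lambda_1,\lambda_2)\in\mathbb{C}^2$. **Diffeomorphisms and normal form.** $\Phi_*(Y):=(\mathrm{D}\Phi\cdot Y)\circ\Phi^{-1}$. A diffeomorphism is fibered if it has the form $(x,\mathbf{y})\mapsto(x,\phi(x,\mathbf{y}))$. For every strictly non-degenerate, div-integrable diagonal doubly-resonant saddle-node $Y$ there is a unique formal fibered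 diffeomorphism $\hat\Phi$ tangent to the identity (the formal normalizing map) such that $\hat\Phi_*(Y)=x^2\partial_x+(-\lambda+a_1x+c_1(y_1y_2))y_1\partial_{y_1}+(\lambda+a_2x+c_2(y_1y_2))y_2\partial_{y_2}=:Y_{\mathrm{norm}}$ (the formal normal form of $Y$) with $a_1,a_2\in\mathbb{C}$, $a_1+a_2=\operatorname{res}(Y)$ and $c_1,c_2\in v\mathbb{C}[[v]]$; for such $Y$ one has moreover $c_1,c_2\in\mathbb{C}\{v\}$ and $c_1+c_2=0$. **Sectorial germs.** A sectorial neighborhood of the origin in the direction $\theta$ with opening $\eta$ is an open set of $\mathbb{C}^3$ containing $\{0<|x|<r,\ |\arg x-\theta|<\eta/2+\epsilon\}\times\mathbf{D}(\mathbf{0},\mathbf{r})$ for some $r,\epsilon>0$ and some polydisc $\mathbf{D}(\mathbf{0},\mathbf{r})\subset\mathbb{C}^2$ centered at the origin. Germs are taken with respect to restriction to smaller such neighborhoods. A sectorial fibered diffeomorphism on a sectorial neighborhood $\mathcal S$ is a holomorphic fibered diffeomorphism $\Phi:\mathcal{S}\to\Phi(\mathcal{S})$; it is (asymptotically) tangent to the identity if $\Phi(x,\mathbf{y})-(x,\mathbf{y})=O(\|(x,\mathbf{y})\|^2)$ as $(x,\mathbf{y})\to(0,\mathbf 0)$ in $\mathcal S$. **Weak 1-sums.** A series $\hat F=\sum_kF_kx^k\in\mathbb{C}[[x]]$ is 1-summable in the direction $\theta$ with 1-sum $F_\theta$ if $F_\theta$ is analytic on a sector bisected by $\theta$ of opening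 $>\pi$ and for every closed subsector there are $A,C>0$ with $|F_\theta(x)-\sum_{k<N}F_kx^k|\le AC^NN!|x|^N$ for all $N$. A series $\hat f=\sum_{\mathbf{j}}\hat F_{\mathbf{j}}(x)\mathbf{y}^{\mathbf{j}}$ is weakly 1-summable in the direction $\theta$ if each $\hat F_{\mathbf{j}}$ is 1-summable in the direction $\theta$ and $\sum_{\mathbf j}F_{\mathbf{j},\theta}(x)\mathbf{y}^{\mathbf{j}}$ defines a germ of holomorphic function (the weak 1-sum) in a sectorial neighborhood in the direction $\theta$ with opening $>\pi$. For maps this is meant componentwise. For every strictly non-degenerate, div-integrable diagonal doubly-resonant saddle-node $Y$, the formal normalizing map $\hat\Phi$ is weakly 1-summable in every direction except $\arg(\pm\lambda)$, and its weak 1-sums $\Phi_\pm$ in the directions $\arg(\pm i\lambda)$ are sectorial fibered diffeomorphisms tangent to the identity on domains $S_\pm\times(\mathbb{C}^2,0)$ conjugating $Y$ to $Y_{\mathrm{norm}}$. *)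

theory Defs
  imports "HOL-Analysis.Analysis" "HOL-Library.Landau_Symbols"
begin

unbundle no fps_syntax

section \<open>Power series in \<open>(x, y1, y2)\<close>\<close>

text \<open>\<open>C[[x]][[y1]][[y2]]\<close>: \<open>x\<close> is the innermost and \<open>y2\<close> the outermost variable, so that the
  coefficient of \<open>y1^i y2^j\<close> is a series in \<open>x\<close>.\<close>

type_synonym mfps = "complex fps fps fps"

definition ycoeff :: "mfps \<Rightarrow> nat \<Rightarrow> nat \<Rightarrow> complex fps" where
  "ycoeff F i j = fps_nth (fps_nth F j) i"

definition mcoeff :: "mfps \<Rightarrow> nat \<Rightarrow> nat \<Rightarrow> nat \<Rightarrow> complex" where
  "mcoeff F k i j = fps_nth (ycoeff F i j) k"

definition mfps_of :: "(nat \<Rightarrow> nat \<Rightarrow> complex fps) \<Rightarrow> mfps" where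
  "mfps_of f = Abs_fps (\<lambda>j. Abs_fps (\<lambda>i. f i j))"

definition mconst :: "complex \<Rightarrow> mfps" where
  "mconst c = fps_const (fps_const (fps_const c))"

definition mX :: mfps where "mX = fps_const (fps_const fps_X)"
definition mY1 :: mfps where "mY1 = fps_const fps_X"
definition mY2 :: mfps where "mY2 = fps_X"

definition mderiv_x :: "mfps \<Rightarrow> mfps" where
  "mderiv_x F = mfps_of (\<lambda>i j. fps_deriv (ycoeff F i j))"

definition mderiv_y1 :: "mfps \<Rightarrow> mfps" where
  "mderiv_y1 F = mfps_of (\<lambda>i j. of_nat (Suc i) * ycoeff F (Suc i) j)"

definition mderiv_y2 :: "mfps \<Rightarrow> mfps" where
  "mderiv_y2 F = mfps_of (\<lambda>i j. of_nat (Suc j) * ycoeff F i (Suc j))"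

text \<open>\<open>c(w)\<close> for \<open>c \<in> C[[v]]\<close> and \<open>w\<close> without constant term: \<open>w ^ n\<close> then has order at least \<open>n\<close>,
  so truncating the sum at the total degree loses nothing.\<close>

definition msubst :: "complex fps \<Rightarrow> mfps \<Rightarrow> mfps" where
  "msubst c w = mfps_of (\<lambda>i j. Abs_fps (\<lambda>k. \<Sum>n\<le>k + i + j. fps_nth c n * mcoeff (w ^ n) k i j))"

definition order_ge_2 :: "mfps \<Rightarrow> bool" where
  "order_ge_2 F \<longleftrightarrow> (\<forall>k i j. k + i + j < 2 \<longrightarrow> mcoeff F k i j = 0)"

definition convergent_mfps :: "mfps \<Rightarrow> bool" where
  "convergent_mfps F \<longleftrightarrow>
     (\<exists>r>0. (\<lambda>(k, i, j). norm (mcoeff F k i j) * r ^ (k + i + j)) summable_on UNIV)"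

definition eval_mfps :: "mfps \<Rightarrow> complex ^ 3 \<Rightarrow> complex" where
  "eval_mfps F p = (\<Sum>\<^sub>\<infinity>(k, i, j)\<in>UNIV. mcoeff F k i j * (p $ 1) ^ k * (p $ 2) ^ i * (p $ 3) ^ j)"


section \<open>Holomorphic maps and push-forward of vector fields\<close>

definition holo_fun_on :: "(complex ^ 'n \<Rightarrow> complex) \<Rightarrow> (complex ^ 'n) set \<Rightarrow> bool" where
  "holo_fun_on f S \<longleftrightarrow>
     (\<forall>p\<in>S. \<exists>a::complex ^ 'n. (f has_derivative (\<lambda>v. \<Sum>i\<in>UNIV. a $ i * v $ i)) (at p))"

definition holo_map_on :: "(complex ^ 'n \<Rightarrow> complex ^ 'm) \<Rightarrow> (complex ^ 'n) set \<Rightarrow> bool" where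
  "holo_map_on f S \<longleftrightarrow> (\<forall>i. holo_fun_on (\<lambda>p. f p $ i) S)"

definition biholo_on :: "(complex ^ 'n \<Rightarrow> complex ^ 'n) \<Rightarrow> (complex ^ 'n) set \<Rightarrow> bool" where
  "biholo_on f S \<longleftrightarrow> open S \<and> holo_map_on f S \<and> inj_on f S \<and>
     open (f ` S) \<and> holo_map_on (inv_into S f) (f ` S)"

text \<open>\<open>\<Phi>\<^sub>*(Y) = (D\<Phi> \<cdot> Y) \<circ> \<Phi>\<inverse>\<close>, for \<open>\<Phi>\<close> injective on \<open>S\<close>; meaningful on \<open>\<Phi> ` S\<close>.\<close>

definition pushforward ::
  "(complex ^ 'n) set \<Rightarrow> (complex ^ 'n \<Rightarrow> complex ^ 'n) \<Rightarrow> (complex ^ 'n \<Rightarrow> complex ^ 'n)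
     \<Rightarrow> complex ^ 'n \<Rightarrow> complex ^ 'n" where
  "pushforward S \<Phi> Y q =
     (let p = inv_into S \<Phi> q in frechet_derivative \<Phi> (at p) (Y p))"


section \<open>Diagonal doubly-resonant saddle-nodes\<close>

text \<open>The vector field \<open>x\<^sup>2 \<partial>\<^sub>x + (-\<lambda> y1 + F1) \<partial>\<^sub>y\<^sub>1 + (\<lambda> y2 + F2) \<partial>\<^sub>y\<^sub>2\<close> is given by its data
  \<open>(\<lambda>, F1, F2)\<close>, where \<open>F1, F2\<close> are convergent power series of order at least two.\<close>

definition diagonal_drsn :: "complex \<Rightarrow> mfps \<Rightarrow> mfps \<Rightarrow> bool" where
  "diagonal_drsn l F1 F2 \<longleftrightarrow> l \<noteq> 0 \<and>
     convergent_mfps F1 \<and> order_ge_2 F1 \<and> convergent_mfps F2 \<and> order_ge_2 F2"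

definition drsn_field :: "complex \<Rightarrow> mfps \<Rightarrow> mfps \<Rightarrow> complex ^ 3 \<Rightarrow> complex ^ 3" where
  "drsn_field l F1 F2 p =
     vector [(p $ 1)\<^sup>2, - l * p $ 2 + eval_mfps F1 p, l * p $ 3 + eval_mfps F2 p]"

text \<open>The two summands are the diagonal entries of the matrix \<open>A(x)\<close>, i.e. the coefficient of \<open>y1\<close>
  in the first and of \<open>y2\<close> in the second \<open>y\<close>-component.\<close>

definition trace_lin :: "complex \<Rightarrow> mfps \<Rightarrow> mfps \<Rightarrow> complex fps" where
  "trace_lin l F1 F2 =
     ycoeff (- mconst l * mY1 + F1) 1 0 + ycoeff (mconst l * mY2 + F2) 0 1"

definition residue_drsn :: "complex \<Rightarrow> mfps \<Rightarrow> mfps \<Rightarrow> complex" where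
  "residue_drsn l F1 F2 = fps_nth (trace_lin l F1 F2 / fps_X) 0"

definition strictly_nondegenerate :: "complex \<Rightarrow> mfps \<Rightarrow> mfps \<Rightarrow> bool" where
  "strictly_nondegenerate l F1 F2 \<longleftrightarrow> Re (residue_drsn l F1 F2) > 0"

definition restrict_x0 :: "(complex ^ 3 \<Rightarrow> complex ^ 3) \<Rightarrow> complex ^ 2 \<Rightarrow> complex ^ 2" where
  "restrict_x0 Y y = (let q = Y (vector [0, y $ 1, y $ 2]) in vector [q $ 2, q $ 3])"

definition div_integrable :: "(complex ^ 3 \<Rightarrow> complex ^ 3) \<Rightarrow> bool" where
  "div_integrable Y \<longleftrightarrow>
     (\<exists>W \<psi> U m1 m2. 0 \<in> W \<and> biholo_on \<psi> W \<and> \<psi> 0 = 0 \<and>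
        holo_fun_on U (\<psi> ` W) \<and> U 0 \<noteq> 0 \<and>
        (\<forall>y\<in>\<psi> ` W. pushforward W \<psi> (restrict_x0 Y) y = U y *s vector [m1 * y $ 1, m2 * y $ 2]))"


section \<open>Formal normalization\<close>

definition normal_form :: "complex \<Rightarrow> complex \<Rightarrow> complex \<Rightarrow> complex fps \<Rightarrow> complex fps
     \<Rightarrow> complex ^ 3 \<Rightarrow> complex ^ 3" where
  "normal_form l a1 a2 c1 c2 p =
     vector [(p $ 1)\<^sup>2,
             (- l + a1 * p $ 1 + eval_fps c1 (p $ 2 * p $ 3)) * p $ 2,
             (l + a2 * p $ 1 + eval_fps c2 (p $ 2 * p $ 3)) * p $ 3]"

text \<open>The Lie derivative of a formal series along the vector field with data \<open>(\<lambda>, F1, F2)\<close>.\<close>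

definition drsn_lie :: "complex \<Rightarrow> mfps \<Rightarrow> mfps \<Rightarrow> mfps \<Rightarrow> mfps" where
  "drsn_lie l F1 F2 h =
     mX\<^sup>2 * mderiv_x h + (- mconst l * mY1 + F1) * mderiv_y1 h + (mconst l * mY2 + F2) * mderiv_y2 h"

text \<open>The formal fibered diffeomorphism \<open>(x, h1, h2)\<close> is tangent to the identity and pushes the
  vector field \<open>Y\<close> with data \<open>(\<lambda>, F1, F2)\<close> forward to the normal form \<open>Z\<close> with data
  \<open>(\<lambda>, a1, a2, c1, c2)\<close>. The push-forward equation is written as \<open>D\<Phi> \<cdot> Y = Z \<circ> \<Phi>\<close>, whose
  first component reads \<open>x\<^sup>2 = x\<^sup>2\<close>. Convergence of \<open>c1\<close> and \<open>c2\<close>, which holds automatically for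
  div-integrable fields, is recorded so that \<^const>\<open>normal_form\<close> is an analytic vector field.\<close>

definition formal_normalization :: "complex \<Rightarrow> mfps \<Rightarrow> mfps
     \<Rightarrow> complex \<Rightarrow> complex \<Rightarrow> complex fps \<Rightarrow> complex fps \<Rightarrow> mfps \<Rightarrow> mfps \<Rightarrow> bool" where
  "formal_normalization l F1 F2 a1 a2 c1 c2 h1 h2 \<longleftrightarrow>
     a1 + a2 = residue_drsn l F1 F2 \<and>
     fps_nth c1 0 = 0 \<and> fps_nth c2 0 = 0 \<and> fps_conv_radius c1 > 0 \<and> fps_conv_radius c2 > 0 \<and>
     order_ge_2 (h1 - mY1) \<and> order_ge_2 (h2 - mY2) \<and>
     drsn_lie l F1 F2 h1 = (- mconst l + mconst a1 * mX + msubst c1 (h1 * h2)) * h1 \<and>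
     drsn_lie l F1 F2 h2 = (mconst l + mconst a2 * mX + msubst c2 (h1 * h2)) * h2"


section \<open>Sectorial germs\<close>

text \<open>A direction is given by a nonzero complex number \<open>d\<close> with \<open>arg d = \<theta>\<close>. The sector has opening
  \<open>\<pi> + 2 \<epsilon>\<close>; since \<^const>\<open>Arg\<close> is the principal argument, it is only used with \<open>\<epsilon> < \<pi>/2\<close>.\<close>

definition sector :: "complex \<Rightarrow> real \<Rightarrow> real \<Rightarrow> complex set" where
  "sector d \<epsilon> r = {x. 0 < norm x \<and> norm x < r \<and> \<bar>Arg (x / d)\<bar> < pi / 2 + \<epsilon>}"

definition sector_nbhd :: "complex \<Rightarrow> real \<Rightarrow> real \<Rightarrow> (complex ^ 3) set" where
  "sector_nbhd d \<epsilon> r = {p. p $ 1 \<in> sector d \<epsilon> r \<and> norm (p $ 2) < r \<and> norm (p $ 3) < r}"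

definition germ_eq ::
  "complex \<Rightarrow> real \<Rightarrow> (complex ^ 3 \<Rightarrow> complex ^ 3) \<Rightarrow> (complex ^ 3 \<Rightarrow> complex ^ 3) \<Rightarrow> bool" where
  "germ_eq d \<epsilon> \<Phi> \<Psi> \<longleftrightarrow> (\<exists>r>0. \<forall>p\<in>sector_nbhd d \<epsilon> r. \<Phi> p = \<Psi> p)"

definition fibered_on :: "(complex ^ 3) set \<Rightarrow> (complex ^ 3 \<Rightarrow> complex ^ 3) \<Rightarrow> bool" where
  "fibered_on S \<Phi> \<longleftrightarrow> (\<forall>p\<in>S. \<Phi> p $ 1 = p $ 1)"

definition tangent_to_id_on :: "(complex ^ 3) set \<Rightarrow> (complex ^ 3 \<Rightarrow> complex ^ 3) \<Rightarrow> bool" where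
  "tangent_to_id_on S \<Phi> \<longleftrightarrow> (\<lambda>p. norm (\<Phi> p - p)) \<in> O[at 0 within S](\<lambda>p. (norm p)\<^sup>2)"

text \<open>The germ of \<open>\<Phi>\<close> on \<open>sector \<times> (C\<^sup>2, 0)\<close> is a sectorial fibered diffeomorphism tangent to the
  identity with \<open>\<Phi>\<^sub>*(Y) = Z\<close>.\<close>

definition sectorial_conjugation :: "complex \<Rightarrow> real
     \<Rightarrow> (complex ^ 3 \<Rightarrow> complex ^ 3) \<Rightarrow> (complex ^ 3 \<Rightarrow> complex ^ 3)
     \<Rightarrow> (complex ^ 3 \<Rightarrow> complex ^ 3) \<Rightarrow> bool" where
  "sectorial_conjugation d \<epsilon> Y Z \<Phi> \<longleftrightarrow>
     (\<exists>r>0. let S = sector_nbhd d \<epsilon> r in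
        biholo_on \<Phi> S \<and> fibered_on S \<Phi> \<and> tangent_to_id_on S \<Phi> \<and>
        (\<forall>q\<in>\<Phi> ` S. pushforward S \<Phi> Y q = Z q))"


section \<open>Weak 1-sums\<close>

text \<open>Each coefficient may have its own sector for the Gevrey estimates; every closed subsector is
  contained in a bisected one as below.\<close>

definition one_sum :: "complex \<Rightarrow> complex fps \<Rightarrow> (complex \<Rightarrow> complex) \<Rightarrow> bool" where
  "one_sum d F f \<longleftrightarrow>
     (\<exists>\<delta> \<rho>. 0 < \<delta> \<and> \<delta> < pi / 2 \<and> 0 < \<rho> \<and> f holomorphic_on sector d \<delta> \<rho> \<and>
       (\<forall>\<delta>' \<rho>'. \<delta>' < \<delta> \<longrightarrow> \<rho>' < \<rho> \<longrightarrow>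
         (\<exists>A>0. \<exists>C>0. \<forall>x N. 0 < norm x \<longrightarrow> norm x \<le> \<rho>' \<longrightarrow> \<bar>Arg (x / d)\<bar> \<le> pi / 2 + \<delta>' \<longrightarrow>
            norm (f x - (\<Sum>k<N. fps_nth F k * x ^ k)) \<le> A * C ^ N * fact N * norm x ^ N)))"

definition weak_one_sum ::
  "complex \<Rightarrow> real \<Rightarrow> mfps \<Rightarrow> (complex ^ 3 \<Rightarrow> complex) \<Rightarrow> bool" where
  "weak_one_sum d \<epsilon> h f \<longleftrightarrow>
     (\<exists>H r. 0 < r \<and> (\<forall>i j. one_sum d (ycoeff h i j) (H i j)) \<and>
        holo_fun_on f (sector_nbhd d \<epsilon> r) \<and>
        (\<forall>p\<in>sector_nbhd d \<epsilon> r.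
           ((\<lambda>(i, j). H i j (p $ 1) * (p $ 2) ^ i * (p $ 3) ^ j) has_sum f p) UNIV))"

text \<open>The sectorial normalizing map of \<open>Y\<close> in the direction \<open>d\<close>: the weak 1-sum \<open>\<Phi>\<close> of the formal
  normalizing map \<open>(x, h1, h2)\<close>; its known properties as a sectorial fibered diffeomorphism tangent to the identity
  conjugating \<open>Y\<close> to its normal form \<open>Z\<close> are recorded as part of the notion.\<close>

definition sectorial_normalizing_map :: "complex \<Rightarrow> real
     \<Rightarrow> (complex ^ 3 \<Rightarrow> complex ^ 3) \<Rightarrow> (complex ^ 3 \<Rightarrow> complex ^ 3)
     \<Rightarrow> mfps \<Rightarrow> mfps \<Rightarrow> (complex ^ 3 \<Rightarrow> complex ^ 3) \<Rightarrow> bool" where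
  "sectorial_normalizing_map d \<epsilon> Y Z h1 h2 \<Phi> \<longleftrightarrow>
     weak_one_sum d \<epsilon> mX (\<lambda>p. \<Phi> p $ 1) \<and>
     weak_one_sum d \<epsilon> h1 (\<lambda>p. \<Phi> p $ 2) \<and>
     weak_one_sum d \<epsilon> h2 (\<lambda>p. \<Phi> p $ 3) \<and>
     sectorial_conjugation d \<epsilon> Y Z \<Phi>"

end

(*  Both sectorial maps conjugate Y to the same normal form Z, so U = phi o Phi^(-1) is a sectorial isotropy
    of Z tangent to the identity, and E = U - id has to vanish. The axis y = 0 is invariant under Z and E
    satisfies a scalar linear equation there, whose nonzero solutions explode along a ray. Off the axis, suppose
    E = O(|y|^n) with n >= 1. The terms of Z of higher order in y do not contribute to the homogeneous part of
    degree n of E; following it along a solution (g 2, g 3) of the linear part of Z, it is a constant multiple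
    of g 2, respectively g 3. On a curve on which |g 2| and |g 3| are both of size |x|^b, with
    2b = Re (res Y) > 0, homogeneity makes this constant zero if n >= 2, and tangency to the identity does so
    if n = 1. Hence E = O(|y|^(n+1)), with a bound K (|y| / r)^(n+1) whose constants do not depend on n. *)

theory Submission
  imports Defs "HOL-Complex_Analysis.Conformal_Mappings" "HOL-Real_Asymp.Real_Asymp"
begin

section \<open>Holomorphic functions\<close>

text \<open>The homogeneous part of degree n is never split into monomials: divided by
  \<open>g i\<close>, these would carry different powers of exp (l / x) and call for different rays.
  It is read off on complex lines as the limit of E (x, s u, s v) / s^n and bounded as a whole. At
  balanced points this bound is of size |x|^(b n), against |x|^b for \<open>g i\<close>, which
  leaves |x|^(b (n - 1)); for n = 1 nothing is left, and a factor |x| has to come from elsewhere.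
  The curve must be bent. On the ray through d both exp (l / x) and exp (- l / x) have modulus 1,
  but only the sum of Re (a 2) and Re (a 3) is known to be positive, so one of the two rates may
  fail to decay there. A drift of logarithmic size shifts powers of |x| from one rate to the other.
  The errors of the transport depend on n and x without any uniformity, but they are two orders
  higher in s and disappear in the limit s -> 0. The induction on n passes only through the Schwarz
  lemma on a disc of radius r, which loses neither K nor r.\<close>

lemma factor_power:
  assumes f: "f holomorphic_on ball 0 r" and "r > 0"
    and bd: "\<And>s. s \<in> ball 0 r \<Longrightarrow> norm (f s) \<le> K * norm s ^ n"
  obtains g where "g holomorphic_on ball 0 r" "\<And>s. s \<in> ball 0 r \<Longrightarrow> f s = s ^ n * g s"
    "\<And>s. s \<in> ball 0 r \<Longrightarrow> norm (g s) \<le> K"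
proof -
  have hol: "(\<lambda>s. f s / s ^ n) holomorphic_on ball 0 r - {0}"
    by (intro holomorphic_intros holomorphic_on_subset[OF f]) auto
  have bd': "norm (f s / s ^ n) \<le> K" if "s \<in> ball 0 r - {0}" for s
    using bd[of s] that by (simp add: norm_divide norm_power field_simps)
  moreover have ev: "eventually (\<lambda>s. s \<in> ball 0 r - {0}) (at (0::complex))"
    using \<open>r > 0\<close> by (intro eventually_at_in_open) auto
  ultimately have "\<exists>B. eventually (\<lambda>s. norm (f s / s ^ n) \<le> B) (at 0)"
    by (metis (no_types, lifting) eventually_mono)
  with hol obtain g where g: "g holomorphic_on ball 0 r"
    and gf: "\<And>s. s \<in> ball 0 r - {0} \<Longrightarrow> g s = f s / s ^ n"
    using holomorphic_on_extend_bounded[of "\<lambda>s. f s / s ^ n" "ball 0 r" 0] \<open>r > 0\<close> by auto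
  have g0: "(g \<longlongrightarrow> g 0) (at 0)"
    using holomorphic_on_imp_continuous_on[OF g] \<open>r > 0\<close>
    by (metis centre_in_ball continuous_on_eq_continuous_at isContD open_ball)
  have gb: "norm (g s) \<le> K" if "s \<in> ball 0 r" for s
  proof (cases "s = 0")
    case True
    have "norm (g 0) \<le> K"
      using tendsto_norm[OF g0] by (rule tendsto_upperbound) (use ev in \<open>auto elim!: eventually_mono simp: gf bd' simp del: mem_ball\<close>)
    then show ?thesis using True by simp
  next
    case False
    then show ?thesis using that bd'[of s] gf[of s] by simp
  qed
  have "f s = s ^ n * g s" if "s \<in> ball 0 r" for s
  proof (cases "s = 0")
    case True
    have "isCont f 0"
      using holomorphic_on_imp_continuous_on[OF f] \<open>r > 0\<close>
      by (metis centre_in_ball continuous_on_eq_continuous_at open_ball)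
    then have "(f \<longlongrightarrow> f 0) (at 0)" by (simp add: isCont_def)
    moreover have "((\<lambda>s. s ^ n * g s) \<longlongrightarrow> 0 ^ n * g 0) (at 0)"
      by (intro tendsto_intros g0)
    then have "(f \<longlongrightarrow> 0 ^ n * g 0) (at 0)"
      by (rule Lim_transform_eventually) (use ev in \<open>auto elim!: eventually_mono simp: gf\<close>)
    ultimately show ?thesis
      using LIM_unique True by blast
  next
    case False
    then show ?thesis using that gf[of s] by simp
  qed
  with g gb show ?thesis by (intro that)
qed

lemma Schwarz_bound:
  assumes g: "g holomorphic_on ball 0 r" and bd: "\<And>s. s \<in> ball 0 r \<Longrightarrow> norm (g s) \<le> K"
    and g0: "g 0 = 0" and s: "s \<in> ball 0 r"
  shows "norm (g s) \<le> K * norm s / r"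
proof -
  have r: "r > 0" using s by (metis mem_ball_0 norm_ge_zero order_le_less_trans)
  have K: "K \<ge> 0" using bd[OF s] by (meson norm_ge_zero order_trans)
  \<comment> \<open>\<open>Schwarz_Lemma\<close> wants a strict bound by 1, so g is scaled by some
    K' > K, which is positive even when K = 0; K' then tends to K.\<close>
  have *: "norm (g s) \<le> K' * (norm s / r)" if "K' > K" for K'
  proof -
    define h where "h = (\<lambda>z. g (of_real r * z) / of_real K')"
    have K': "K' > 0" using that K by simp
    have in_ball: "of_real r * z \<in> ball 0 r" if "norm z < 1" for z :: complex
      using that r by (simp add: norm_mult)
    have "norm (h (s / of_real r)) \<le> norm (s / of_real r)"
    proof (rule Schwarz_Lemma(1))
      have "g \<circ> (*) (of_real r) holomorphic_on ball 0 1"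
        by (intro holomorphic_on_compose holomorphic_intros holomorphic_on_subset[OF g])
          (use in_ball in auto)
      then show "h holomorphic_on ball 0 1"
        unfolding h_def o_def using K' by (intro holomorphic_intros) auto
      show "h 0 = 0" by (simp add: h_def g0)
      show "norm (h z) < 1" if "norm z < 1" for z
        using bd[OF in_ball[OF that]] \<open>K' > K\<close> K' by (simp add: h_def norm_divide)
      show "norm (s / of_real r) < 1" using s r by (simp add: norm_divide)
    qed
    then show ?thesis
      using r K' by (simp add: h_def norm_divide field_simps)
  qed
  have "((\<lambda>K'. K' * (norm s / r)) \<longlongrightarrow> K * (norm s / r)) (at_right K)"
    by (intro tendsto_intros)
  then have "norm (g s) \<le> K * (norm s / r)"
    by (rule tendsto_lowerbound) (use * in \<open>auto simp: eventually_at_right_less eventually_at_filter\<close>)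
  then show ?thesis by simp
qed

text \<open>Holomorphy on \<open>complex ^ 3\<close> is real differentiability with a complex linear
  differential; along a complex curve this gives back a complex derivative.\<close>

lemma chain_vector_3:
  fixes u :: "complex ^ 3 \<Rightarrow> complex"
  assumes u: "(u has_derivative (\<lambda>v. \<Sum>j\<in>UNIV. a $ j * v $ j)) (at (vector [x t, y t, z t]))"
    and "(x has_field_derivative x') (at t within T)" "(y has_field_derivative y') (at t within T)"
      "(z has_field_derivative z') (at t within T)"
  shows "((\<lambda>t. u (vector [x t, y t, z t])) has_field_derivative a $ 1 * x' + a $ 2 * y' + a $ 3 * z')
    (at t within T)"
proof -
  let ?p = "\<lambda>t. vector [x t, y t, z t] :: complex ^ 3"
  have eq: "?p = (\<lambda>t. x t *s axis 1 1 + y t *s axis 2 1 + z t *s axis 3 1)"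
    by (intro ext) (simp add: vec_eq_iff axis_def forall_3)
  have ax: "c *s axis k 1 = axis k c" for c :: complex and k :: 3
    by (simp add: vec_eq_iff axis_def)
  have norm_ax: "norm (axis k c) = norm c" for c :: complex and k :: 3
    using exhaust_3[of k] by (auto simp: norm_vec_def L2_set_def sum_3 axis_def)
  have bl: "bounded_linear (\<lambda>c. c *s axis k 1 :: complex ^ 3)" for k
    unfolding ax by (rule bounded_linear_intro[where K = 1])
      (simp_all only: norm_ax mult_1_right order_refl, simp_all add: vec_eq_iff axis_def)
  have "(?p has_derivative (\<lambda>h. (x' * h) *s axis 1 1 + (y' * h) *s axis 2 1 + (z' * h) *s axis 3 1))
      (at t within T)"
    unfolding eq using assms(2-4) unfolding has_field_derivative_def
    by (intro has_derivative_add bounded_linear.has_derivative[OF bl])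
  then have "((\<lambda>t. u (?p t)) has_derivative (\<lambda>h. \<Sum>j\<in>UNIV. a $ j *
      ((x' * h) *s axis 1 1 + (y' * h) *s axis 2 1 + (z' * h) *s axis 3 1) $ j)) (at t within T)"
    by (rule has_derivative_compose[where f = ?p and g = u, OF _ u])
  moreover have "(\<Sum>j\<in>UNIV. a $ j *
      ((x' * h) *s axis 1 1 + (y' * h) *s axis 2 1 + (z' * h) *s axis 3 1) $ j)
      = (a $ 1 * x' + a $ 2 * y' + a $ 3 * z') * h" for h
    by (simp add: sum_3 axis_def algebra_simps)
  ultimately show ?thesis
    by (simp add: has_field_derivative_def)
qed

section \<open>Sectors and the rates of the linear part\<close>

lemma sector_mono: "r \<le> s \<Longrightarrow> sector d \<epsilon> r \<subseteq> sector d \<epsilon> s"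
  by (auto simp: sector_def)

lemma sector_not_nonpos:
  assumes "x \<in> sector d \<epsilon> r" "\<epsilon> < pi / 2" "d \<noteq> 0"
  shows "x \<noteq> 0" "x / d \<notin> \<real>\<^sub>\<le>\<^sub>0"
proof -
  show "x \<noteq> 0" using assms by (auto simp: sector_def)
  show "x / d \<notin> \<real>\<^sub>\<le>\<^sub>0"
  proof
    assume "x / d \<in> \<real>\<^sub>\<le>\<^sub>0"
    moreover have "x / d \<noteq> 0" using \<open>x \<noteq> 0\<close> \<open>d \<noteq> 0\<close> by simp
    ultimately have "Arg (x / d) = pi"
      unfolding Arg_eq_pi complex_nonpos_Reals_iff complex_eq_iff[of _ 0] by auto
    then show False using assms by (auto simp: sector_def)
  qed
qed

text \<open>In the coordinate w = Ln (x / d) a sector is a convex half-strip, whence its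
  connectedness.\<close>

lemma sector_eq_image:
  assumes "d \<noteq> 0" "r > 0" "\<epsilon> < pi / 2"
  shows "sector d \<epsilon> r = (\<lambda>w. d * exp w) ` {w. Re w < ln (r / norm d) \<and> \<bar>Im w\<bar> < pi / 2 + \<epsilon>}"
proof (intro equalityI subsetI)
  fix x assume x: "x \<in> sector d \<epsilon> r"
  then have "x \<noteq> 0" by (auto simp: sector_def)
  then have "x = d * exp (Ln (x / d))" using assms by simp
  moreover have "Re (Ln (x / d)) < ln (r / norm d)"
    using x \<open>x \<noteq> 0\<close> assms by (simp add: sector_def norm_divide divide_strict_right_mono)
  moreover have "\<bar>Im (Ln (x / d))\<bar> < pi / 2 + \<epsilon>"
    using x \<open>x \<noteq> 0\<close> assms by (simp add: sector_def Arg_eq_Im_Ln)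
  ultimately show "x \<in> (\<lambda>w. d * exp w) ` {w. Re w < ln (r / norm d) \<and> \<bar>Im w\<bar> < pi / 2 + \<epsilon>}"
    by blast
next
  fix x assume "x \<in> (\<lambda>w. d * exp w) ` {w. Re w < ln (r / norm d) \<and> \<bar>Im w\<bar> < pi / 2 + \<epsilon>}"
  then obtain w where w: "x = d * exp w" "Re w < ln (r / norm d)" "\<bar>Im w\<bar> < pi / 2 + \<epsilon>" by auto
  have "exp (Re w) < r / norm d"
    using w(2) assms by (metis divide_pos_pos exp_less_cancel_iff exp_ln zero_less_norm_iff)
  moreover have "Arg (exp w) = Im w"
    using w(3) assms(3) by (simp add: Arg_exp)
  ultimately show "x \<in> sector d \<epsilon> r"
    using w assms by (simp add: sector_def norm_mult field_simps)
qed

lemma connected_sector: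
  assumes "d \<noteq> 0" "r > 0" "\<epsilon> < pi / 2"
  shows "connected (sector d \<epsilon> r)"
proof -
  have "{w. Re w < ln (r / norm d) \<and> \<bar>Im w\<bar> < pi / 2 + \<epsilon>} =
      {w. Re w < ln (r / norm d)} \<inter> {w. Im w < pi / 2 + \<epsilon>} \<inter> {w. Im w > - (pi / 2 + \<epsilon>)}"
    by auto
  then have "connected {w. Re w < ln (r / norm d) \<and> \<bar>Im w\<bar> < pi / 2 + \<epsilon>}"
    by (auto intro!: convex_connected convex_Int simp: convex_halfspace_Re_lt convex_halfspace_Im_lt convex_halfspace_Im_gt)
  then show ?thesis
    unfolding sector_eq_image[OF assms]
    by (intro connected_continuous_image continuous_intros) auto
qed

lemma open_sector:
  assumes "d \<noteq> 0" "\<epsilon> < pi / 2"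
  shows "open (sector d \<epsilon> r)"
proof -
  let ?A = "{x. x / d \<notin> \<real>\<^sub>\<le>\<^sub>0} :: complex set"
  have "open ((\<lambda>x. x / d) -` (- \<real>\<^sub>\<le>\<^sub>0))"
    by (intro open_vimage continuous_intros) (use assms in auto)
  then have A: "open ?A" by (simp add: vimage_def)
  have "continuous_on ?A (\<lambda>x. \<bar>Im (Ln (x / d))\<bar>)"
    by (intro continuous_intros) (use assms in auto)
  from continuous_open_preimage[OF this A, of "{..<pi / 2 + \<epsilon>}"]
  have "open {x \<in> ?A. \<bar>Im (Ln (x / d))\<bar> < pi / 2 + \<epsilon>}"
    by (simp only: vimage_def Int_def lessThan_iff mem_Collect_eq open_lessThan simp_thms)
  then have "open ({x. norm x < r} \<inter> {x \<in> ?A. \<bar>Im (Ln (x / d))\<bar> < pi / 2 + \<epsilon>})"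
    by (intro open_Int open_Collect_less continuous_intros)
  moreover have "sector d \<epsilon> r = {x. norm x < r} \<inter> {x \<in> ?A. \<bar>Im (Ln (x / d))\<bar> < pi / 2 + \<epsilon>}"
  proof (intro set_eqI iffI)
    fix x assume x: "x \<in> sector d \<epsilon> r"
    note * = sector_not_nonpos[OF x assms(2,1)]
    then show "x \<in> {x. norm x < r} \<inter> {x \<in> ?A. \<bar>Im (Ln (x / d))\<bar> < pi / 2 + \<epsilon>}"
      using x Arg_eq_Im_Ln[of "x / d"] assms(1) by (simp add: sector_def)
  next
    fix x assume x: "x \<in> {x. norm x < r} \<inter> {x \<in> ?A. \<bar>Im (Ln (x / d))\<bar> < pi / 2 + \<epsilon>}"
    then have "x \<noteq> 0" by auto
    then show "x \<in> sector d \<epsilon> r"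
      using x Arg_eq_Im_Ln[of "x / d"] assms(1) by (simp add: sector_def)
  qed
  ultimately show ?thesis by simp
qed

text \<open>The solution of x^2 g' = (m + a x) g, that is, exp (- m / x) x^a up to a constant.
  Dividing by d moves the cut of the logarithm off the sector.\<close>

definition rate :: "complex \<Rightarrow> complex \<Rightarrow> complex \<Rightarrow> complex \<Rightarrow> complex" where
  "rate d m a x = exp (- m / x + a * Ln (x / d))"

lemma rate_nonzero [simp]: "rate d m a x \<noteq> 0"
  by (simp add: rate_def)

lemma has_field_derivative_rate:
  assumes "x \<noteq> 0" "d \<noteq> 0" "x / d \<notin> \<real>\<^sub>\<le>\<^sub>0"
  shows "(rate d m a has_field_derivative (m + a * x) / x\<^sup>2 * rate d m a x) (at x)"
  unfolding rate_def using assms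
  by (auto intro!: derivative_eq_intros simp: field_simps power2_eq_square)

lemma norm_rate:
  assumes "x \<noteq> 0" "d \<noteq> 0"
  shows "norm (rate d m a x) = exp (Re (- m / x) + Re a * ln (norm (x / d)) - Im a * Arg (x / d))"
  using assms by (simp add: rate_def Arg_eq_Im_Ln)

text \<open>On the curve \<open>d / x = T + \<sigma> / q\<close> with \<open>\<sigma>\<close> a suitable multiple of \<open>ln T\<close>, the two
  exponentials \<open>exp (\<plusminus>l / x)\<close> have just the size that makes both rates comparable.\<close>

lemma balanced_point:
  assumes "d\<^sup>2 = - l\<^sup>2" "l \<noteq> 0" "\<epsilon> > 0"
  obtains B where "\<And>\<rho>. \<rho> > 0 \<Longrightarrow> \<exists>x\<in>sector d \<epsilon> \<rho>.
    \<bar>ln (norm (rate d (- l) a x)) - Re (a + b) / 2 * ln (norm x)\<bar> \<le> B \<and>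
    \<bar>ln (norm (rate d l b x)) - Re (a + b) / 2 * ln (norm x)\<bar> \<le> B"
proof -
  define q where "q = l / d"
  have d: "d \<noteq> 0" using assms by auto
  then have qq: "q * q = -1" using assms by (simp add: q_def field_simps power2_eq_square)
  then have q: "Re q = 0" "norm q = 1"
  proof -
    have "Re q * Re q - Im q * Im q = -1" "Re q * Im q = 0"
      using arg_cong[OF qq, of Re] arg_cong[OF qq, of Im] by auto
    then show "Re q = 0" by (auto) (smt (verit) zero_le_mult_iff)
    have "norm q * norm q = 1" using arg_cong[OF qq, of norm] by (simp add: norm_mult)
    then show "norm q = 1" unfolding square_eq_1_iff using norm_ge_zero[of q] by linarith
  qed
  \<comment> \<open>With q = i or -i and w = T + \<kappa> ln T q, one has Re (l / x) = - \<kappa> ln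
    T. The logarithms of the two rates are then (- \<kappa> - Re a) ln T and (\<kappa> - Re b) ln T
    up to bounded terms; this \<kappa> makes both equal to - \<beta> ln T.\<close>
  define \<kappa> where "\<kappa> = (Re b - Re a) / 2"
  define z where "z = (\<lambda>T. 1 / (of_real T + of_real (\<kappa> * ln T) * q) :: complex)"
  define \<beta> where "\<beta> = Re (a + b) / 2"
  \<comment> \<open>Replacing ln |w| by ln T costs at most 1 per occurrence, the argument at most
    pi, and passing from |x / d| to |x| costs ln |d|.\<close>
  define B where "B = \<bar>Re a\<bar> + \<bar>Re b\<bar> + \<bar>Im a\<bar> * pi + \<bar>Im b\<bar> * pi + \<bar>\<beta>\<bar> * \<bar>ln (norm d)\<bar> + \<bar>\<beta>\<bar>"
  have "((\<lambda>T. \<bar>\<kappa>\<bar> * (ln T / T)) \<longlongrightarrow> \<bar>\<kappa>\<bar> * 0) at_top"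
    by (intro tendsto_intros ln_x_over_x_tendsto_0)
  then have ev: "\<forall>\<^sub>F T in at_top. \<bar>\<kappa>\<bar> * (ln T / T) < 1"
    by (rule order_tendstoD) simp
  show ?thesis
  proof (rule that[of B])
    fix \<rho> :: real assume \<rho>: "\<rho> > 0"
    have "\<forall>\<^sub>F T in at_top. \<bar>\<kappa>\<bar> * (ln T / T) < 1 \<and> T > max 1 (norm d / \<rho>)"
      by (intro eventually_conj ev eventually_gt_at_top)
    then obtain T where T: "\<bar>\<kappa>\<bar> * (ln T / T) < 1" "T > 1" "T > norm d / \<rho>"
      by (auto simp: eventually_at_top_linorder)
    define w where "w = of_real T + of_real (\<kappa> * ln T) * q"
    have Rew: "Re w = T" by (simp add: w_def q)
    have w0: "w \<noteq> 0" using T Rew by auto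
    have "norm (of_real (\<kappa> * ln T) * q) \<le> T"
      using T q by (simp add: norm_mult abs_mult field_simps)
    then have "norm w \<le> 2 * T" unfolding w_def using T by (intro norm_triangle_le) auto
    have "norm w \<ge> T" using Rew T abs_Re_le_cmod[of w] by auto
    have lnw: "ln T \<le> ln (norm w)" "ln (norm w) \<le> ln T + 1"
    proof -
      show "ln T \<le> ln (norm w)" using T \<open>norm w \<ge> T\<close> by (intro ln_mono) auto
      have "ln (norm w) \<le> ln (2 * T)" using w0 \<open>norm w \<le> 2 * T\<close> by (intro ln_mono) auto
      also have "\<dots> = ln 2 + ln T" using T by (simp add: ln_mult)
      also have "\<dots> \<le> ln T + 1" using ln_2_less_1 by simp
      finally show "ln (norm w) \<le> ln T + 1" .
    qed
    define x where "x = d / w"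
    have x0: "x \<noteq> 0" using d w0 by (simp add: x_def)
    have xd: "x / d = inverse w" using d by (simp add: x_def field_simps)
    have "Re (inverse w) > 0"
      using Rew T by (simp add: add_pos_nonneg)
    then have "\<bar>Arg (x / d)\<bar> < pi / 2"
      unfolding xd using w0 Re_Ln_pos_lt[of "inverse w"] Arg_eq_Im_Ln[of "inverse w"]
      by (metis nonzero_imp_inverse_nonzero)
    moreover have "norm x < \<rho>"
    proof -
      have "norm x \<le> norm d / T" using \<open>norm w \<ge> T\<close> T by (simp add: x_def norm_divide frac_le)
      also have "\<dots> < \<rho>" using T \<rho> by (simp add: field_simps)
      finally show ?thesis .
    qed
    ultimately have xs: "x \<in> sector d \<epsilon> \<rho>" using x0 \<open>\<epsilon> > 0\<close> by (simp add: sector_def)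
    have lx: "l / x = q * w" using d w0 by (simp add: x_def q_def)
    have "q * w = of_real T * q + of_real (\<kappa> * ln T) * (q * q)" by (simp add: w_def algebra_simps)
    then have Relx: "Re (l / x) = - \<kappa> * ln T" unfolding lx using q qq by simp
    have lnxd: "ln (norm (x / d)) = - ln (norm w)" unfolding xd using w0 by (simp add: norm_inverse ln_inverse)
    have lnx: "ln (norm x) = ln (norm d) - ln (norm w)" using d w0 by (simp add: x_def norm_divide ln_div)
    have Arg: "\<bar>c * Arg (x / d)\<bar> \<le> \<bar>c\<bar> * pi" for c
      using Arg_bounded[of "x / d"] by (simp add: abs_mult mult_left_mono abs_le_iff)
    have d1: "\<bar>c * (ln (norm w) - ln T)\<bar> \<le> \<bar>c\<bar>" for c
      using lnw by (simp add: abs_mult mult_left_le)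
    \<comment> \<open>The slot \<open>0 * t\<close> takes the ln T term, whose coefficient vanishes
      by \<open>c1\<close>.\<close>
    have tri: "\<bar>0 * t - p - s - u + v\<bar> \<le> P + S + U + V"
      if "\<bar>p\<bar> \<le> P" "\<bar>s\<bar> \<le> S" "\<bar>u\<bar> \<le> U" "\<bar>v\<bar> \<le> V" for t p s u v P S U V :: real
      using that by simp
    have c1: "- \<kappa> - Re a = - \<beta>" "\<kappa> - Re b = - \<beta>"
      by (auto simp: \<kappa>_def \<beta>_def field_simps)
    have "ln (norm (rate d (- l) a x)) - \<beta> * ln (norm x) =
       (- \<kappa> - Re a + \<beta>) * ln T - Re a * (ln (norm w) - ln T) - Im a * Arg (x / d) - \<beta> * ln (norm d)
       + \<beta> * (ln (norm w) - ln T)"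
      unfolding norm_rate[OF x0 d] ln_exp lnxd lnx using Relx by (simp add: algebra_simps)
    then have "\<bar>ln (norm (rate d (- l) a x)) - \<beta> * ln (norm x)\<bar>
        \<le> \<bar>Re a\<bar> + \<bar>Im a\<bar> * pi + \<bar>\<beta>\<bar> * \<bar>ln (norm d)\<bar> + \<bar>\<beta>\<bar>"
      unfolding c1 by (metis tri[OF d1 Arg _ d1] abs_mult order_refl add.left_inverse)
    also have "\<dots> \<le> B" by (simp add: B_def)
    finally have 1: "\<bar>ln (norm (rate d (- l) a x)) - \<beta> * ln (norm x)\<bar> \<le> B" .
    have "ln (norm (rate d l b x)) - \<beta> * ln (norm x) =
       (\<kappa> - Re b + \<beta>) * ln T - Re b * (ln (norm w) - ln T) - Im b * Arg (x / d) - \<beta> * ln (norm d)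
       + \<beta> * (ln (norm w) - ln T)"
      unfolding norm_rate[OF x0 d] ln_exp lnxd lnx using Relx by (simp add: algebra_simps)
    then have "\<bar>ln (norm (rate d l b x)) - \<beta> * ln (norm x)\<bar>
        \<le> \<bar>Re b\<bar> + \<bar>Im b\<bar> * pi + \<bar>\<beta>\<bar> * \<bar>ln (norm d)\<bar> + \<bar>\<beta>\<bar>"
      unfolding c1 by (metis tri[OF d1 Arg _ d1] abs_mult order_refl add.left_inverse)
    also have "\<dots> \<le> B" by (simp add: B_def)
    finally have 2: "\<bar>ln (norm (rate d l b x)) - \<beta> * ln (norm x)\<bar> \<le> B" .
    show "\<exists>x\<in>sector d \<epsilon> \<rho>. \<bar>ln (norm (rate d (- l) a x)) - Re (a + b) / 2 * ln (norm x)\<bar> \<le> B \<and>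
      \<bar>ln (norm (rate d l b x)) - Re (a + b) / 2 * ln (norm x)\<bar> \<le> B"
      using 1 2 xs unfolding \<beta>_def by blast
  qed
qed

section \<open>Sectorial isotropies of the normal form\<close>

text \<open>\<open>U\<close> stands for \<phi> o \<Phi>^(-1), \<open>A\<close> for a row of its
  Jacobian, and \<open>invariance\<close> is DU Z = Z o U in the component i. Of c1 and c2 only a
  Lipschitz bound near 0 and the value 0 there are kept; \<open>small\<close> puts both arguments of
  \<open>c\<close> into the disc of that bound. The indices 2 and 3 are the two
  y-directions.\<close>

locale sectorial_isotropy =
  fixes d l :: complex and \<epsilon> r C L \<delta> :: real and m a :: "3 \<Rightarrow> complex"
    and c :: "3 \<Rightarrow> complex \<Rightarrow> complex" and U :: "complex ^ 3 \<Rightarrow> complex ^ 3"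
  assumes d_square: "d\<^sup>2 = - l\<^sup>2" and l_nonzero: "l \<noteq> 0"
    and \<epsilon>: "0 < \<epsilon>" "\<epsilon> < pi / 2" and r_pos: "0 < r" and C_nonneg: "0 \<le> C" and L_nonneg: "0 \<le> L"
    and m: "m 2 = - l" "m 3 = l" and residue: "Re (a 2 + a 3) > 0"
    and tangent: "\<And>p. p \<in> sector_nbhd d \<epsilon> r \<Longrightarrow> norm (U p - p) \<le> C * (norm p)\<^sup>2"
    and invariance: "\<And>p i. p \<in> sector_nbhd d \<epsilon> r \<Longrightarrow> i \<noteq> 1 \<Longrightarrow>
      \<exists>A::complex ^ 3. ((\<lambda>p. U p $ i) has_derivative (\<lambda>v. \<Sum>j\<in>UNIV. A $ j * v $ j)) (at p) \<and>
        A $ 1 * (p $ 1)\<^sup>2 + (\<Sum>j\<in>{2,3}. A $ j * ((m j + a j * p $ 1 + c j (p $ 2 * p $ 3)) * p $ j)) =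
        (m i + a i * p $ 1 + c i (U p $ 2 * U p $ 3)) * U p $ i"
    and c_lipschitz: "\<And>i v w. norm v < \<delta> \<Longrightarrow> norm w < \<delta> \<Longrightarrow> norm (c i v - c i w) \<le> L * norm (v - w)"
    and c_0: "\<And>i. c i 0 = 0"
    and small: "\<And>p. p \<in> sector_nbhd d \<epsilon> r \<Longrightarrow> norm (p $ 2 * p $ 3) < \<delta> \<and> norm (U p $ 2 * U p $ 3) < \<delta>"
begin

abbreviation "S \<equiv> sector d \<epsilon> r"
abbreviation "N \<equiv> sector_nbhd d \<epsilon> r"

section \<open>Deviation from the identity and its equation\<close>

definition E :: "3 \<Rightarrow> complex ^ 3 \<Rightarrow> complex" where
  "E i p = U p $ i - p $ i"

definition ynorm :: "complex ^ 3 \<Rightarrow> real" where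
  "ynorm p = max (norm (p $ 2)) (norm (p $ 3))"

text \<open>This is C (3 r)^2, the tangency bound on all of \<open>N\<close>, where |x| and
  \<open>ynorm\<close> are below r. It is kept for every order, which lets n go to infinity at the
  end.\<close>

definition K :: real where "K = 9 * C * r\<^sup>2"

definition small_order :: "nat \<Rightarrow> bool" where
  "small_order n \<longleftrightarrow> (\<forall>p\<in>N. \<forall>i. i \<noteq> 1 \<longrightarrow> norm (E i p) \<le> K * (ynorm p / r) ^ n)"

lemma d_nonzero: "d \<noteq> 0"
  using d_square l_nonzero by auto

lemma K_nonneg: "K \<ge> 0"
  using C_nonneg by (simp add: K_def)

lemma N_iff: "p \<in> N \<longleftrightarrow> p $ 1 \<in> S \<and> ynorm p < r"
  by (auto simp: sector_nbhd_def ynorm_def)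

lemma ynorm_nonneg: "ynorm p \<ge> 0"
  by (simp add: ynorm_def le_max_iff_disj)

lemma ynorm_vector: "ynorm (vector [x, s * u, s * v]) = norm s * max (norm u) (norm v)"
  by (simp add: ynorm_def norm_mult max_mult_distrib_left)

lemma norm_le_ynorm: "norm p \<le> norm (p $ 1) + 2 * ynorm p"
proof -
  have "norm p \<le> (\<Sum>i\<in>UNIV. norm (p $ i))" unfolding norm_vec_def by (rule L2_set_le_sum) simp
  then show ?thesis unfolding sum_3 by (auto simp: ynorm_def)
qed

lemma norm_E_le: "p \<in> N \<Longrightarrow> norm (E i p) \<le> C * (norm (p $ 1) + 2 * ynorm p)\<^sup>2"
proof -
  assume p: "p \<in> N"
  have "norm (E i p) \<le> norm (U p - p)"
    using Finite_Cartesian_Product.norm_nth_le[of "U p - p" i] by (simp add: E_def)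
  also have "\<dots> \<le> C * (norm p)\<^sup>2" by (rule tangent[OF p])
  also have "\<dots> \<le> C * (norm (p $ 1) + 2 * ynorm p)\<^sup>2"
    using norm_le_ynorm C_nonneg by (intro mult_left_mono power_mono) auto
  finally show ?thesis .
qed

lemma S_norm: "x \<in> S \<Longrightarrow> 0 < norm x \<and> norm x < r"
  by (simp add: sector_def)

lemma small_order_0: "small_order 0"
  unfolding small_order_def
proof (intro ballI allI impI)
  fix p i assume p: "p \<in> N"
  have "norm (E i p) \<le> C * (norm (p $ 1) + 2 * ynorm p)\<^sup>2" by (rule norm_E_le[OF p])
  also have "\<dots> \<le> C * (3 * r)\<^sup>2"
    using p S_norm[of "p $ 1"] ynorm_nonneg[of p] C_nonneg unfolding N_iff
    by (intro mult_left_mono power_mono) auto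
  finally show "norm (E i p) \<le> K * (ynorm p / r) ^ 0"
    by (simp add: K_def power_mult_distrib)
qed

text \<open>Subtracting the equation of the identity leaves the linear part of Z acting on E, with
  three remainders: the change of \<open>c\<close> under U, \<open>c\<close> acting on E, and the
  nonlinear part of Z differentiating E. Each will turn out two orders higher in y than E.\<close>

lemma E_differentiable:
  assumes "p \<in> N" "i \<noteq> 1"
  obtains A :: "complex ^ 3" where "(E i has_derivative (\<lambda>v. \<Sum>j\<in>UNIV. A $ j * v $ j)) (at p)"
    "A $ 1 * (p $ 1)\<^sup>2 + (\<Sum>j\<in>{2,3}. A $ j * ((m j + a j * p $ 1) * p $ j)) =
      (m i + a i * p $ 1) * E i p
      + (c i (U p $ 2 * U p $ 3) - c i (p $ 2 * p $ 3)) * U p $ i + c i (p $ 2 * p $ 3) * E i p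
      - (\<Sum>j\<in>{2,3}. A $ j * c j (p $ 2 * p $ 3) * p $ j)"
proof -
  obtain A :: "complex ^ 3" where A: "((\<lambda>p. U p $ i) has_derivative (\<lambda>v. \<Sum>j\<in>UNIV. A $ j * v $ j)) (at p)"
    "A $ 1 * (p $ 1)\<^sup>2 + (\<Sum>j\<in>{2,3}. A $ j * ((m j + a j * p $ 1 + c j (p $ 2 * p $ 3)) * p $ j)) =
        (m i + a i * p $ 1 + c i (U p $ 2 * U p $ 3)) * U p $ i"
    using invariance[OF assms] by blast
  have i: "i = 2 \<or> i = 3" using exhaust_3[of i] assms by auto
  let ?B = "A - axis i 1"
  have "((\<lambda>p. U p $ i - p $ i) has_derivative (\<lambda>v. (\<Sum>j\<in>UNIV. A $ j * v $ j) - v $ i)) (at p)"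
    by (intro derivative_intros A bounded_linear.has_derivative[OF bounded_linear_vec_nth])
  moreover have "(\<Sum>j\<in>UNIV. A $ j * v $ j) - v $ i = (\<Sum>j\<in>UNIV. ?B $ j * v $ j)" for v
    using i by (auto simp: sum_3 axis_def algebra_simps)
  ultimately have "(E i has_derivative (\<lambda>v. \<Sum>j\<in>UNIV. ?B $ j * v $ j)) (at p)"
    by (simp add: E_def[abs_def])
  moreover have "?B $ 1 * (p $ 1)\<^sup>2 + (\<Sum>j\<in>{2,3}. ?B $ j * ((m j + a j * p $ 1) * p $ j)) =
      (m i + a i * p $ 1) * E i p
      + (c i (U p $ 2 * U p $ 3) - c i (p $ 2 * p $ 3)) * U p $ i + c i (p $ 2 * p $ 3) * E i p
      - (\<Sum>j\<in>{2,3}. ?B $ j * c j (p $ 2 * p $ 3) * p $ j)"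
  proof -
    have [simp]: "(2::3) \<noteq> 3" "(1::3) \<noteq> 2" "(1::3) \<noteq> 3" by auto
    show ?thesis
      using A(2) i by (elim disjE) (simp_all add: E_def axis_def algebra_simps)
  qed
  ultimately show ?thesis using that by blast
qed

section \<open>Restriction to complex lines through the axis\<close>

lemma E_line_holomorphic:
  assumes "x \<in> S" "i \<noteq> 1" "max (norm u) (norm v) \<le> M" "M > 0"
  shows "(\<lambda>s. E i (vector [x, s * u, s * v])) holomorphic_on ball 0 (r / M)"
proof -
  have "\<exists>f'. ((\<lambda>s. E i (vector [x, s * u, s * v])) has_field_derivative f') (at s)" if "s \<in> ball 0 (r / M)" for s
  proof -
    have "norm s * max (norm u) (norm v) \<le> norm s * M" using assms by (intro mult_left_mono) auto
    also have "\<dots> < r" using that assms by (simp add: field_simps)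
    finally have "vector [x, s * u, s * v] \<in> N"
      unfolding N_iff ynorm_vector using assms by simp
    then obtain A :: "complex ^ 3" where "(E i has_derivative (\<lambda>v. \<Sum>j\<in>UNIV. A $ j * v $ j)) (at (vector [x, s * u, s * v]))"
      using E_differentiable[OF _ assms(2)] by blast
    then have "((\<lambda>s. E i (vector [x, s * u, s * v])) has_field_derivative A $ 1 * 0 + A $ 2 * u + A $ 3 * v) (at s)"
      by (rule chain_vector_3) (auto intro!: derivative_eq_intros)
    then show ?thesis by blast
  qed
  then show ?thesis by (simp add: holomorphic_on_open)
qed

text \<open>If the homogeneous part of degree n vanishes on every line over x, then E / s^n extends
  by 0 to s = 0, and the Schwarz lemma gains a factor \<open>ynorm p / R\<close> with the same B.
  The radius R is left free so that it can also be taken as |x|.\<close>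

lemma norm_E_le_Schwarz:
  assumes "x \<in> S" "i \<noteq> 1"
    and lim: "\<And>u v. ((\<lambda>s. E i (vector [x, s * u, s * v]) / s ^ n) \<longlongrightarrow> 0) (at 0)"
    and zero: "E i (vector [x, 0, 0]) = 0"
    and p: "p \<in> N" "p $ 1 = x"
    and R: "0 < R" "R \<le> r" "ynorm p < R"
    and bd: "\<And>p. p \<in> N \<Longrightarrow> p $ 1 = x \<Longrightarrow> ynorm p < R \<Longrightarrow> norm (E i p) \<le> B * ynorm p ^ n"
  shows "norm (E i p) \<le> B * ynorm p ^ Suc n / R"
proof (cases "ynorm p = 0")
  case True
  then have "p = vector [x, 0, 0]"
    using p by (auto simp: ynorm_def vec_eq_iff forall_3 max_def split: if_splits)
  then show ?thesis using zero True by simp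
next
  case False
  then have \<mu>: "ynorm p > 0" using ynorm_nonneg[of p] by linarith
  \<comment> \<open>The point p lies at s = \<open>ynorm p\<close> on the line through (u, v),
    scaled so that \<open>ynorm\<close> on it is |s|.\<close>
  define u v where "u = p $ 2 / of_real (ynorm p)" and "v = p $ 3 / of_real (ynorm p)"
  have uv: "max (norm u) (norm v) = 1"
    using \<mu> by (auto simp: u_def v_def norm_divide max_def ynorm_def split: if_splits)
  let ?f = "\<lambda>s. E i (vector [x, s * u, s * v])"
  have holo: "?f holomorphic_on ball 0 R"
    using E_line_holomorphic[OF assms(1,2), of u v 1] uv R by (auto intro: holomorphic_on_subset)
  have inN: "vector [x, s * u, s * v] \<in> N" if "s \<in> ball 0 R" for s
    using that assms(1) R by (simp add: N_iff ynorm_vector uv)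
  have "norm (?f s) \<le> B * norm s ^ n" if "s \<in> ball 0 R" for s
    using bd[OF inN[OF that]] that by (simp add: ynorm_vector uv)
  from factor_power[OF holo R(1) this] obtain g where g: "g holomorphic_on ball 0 R"
    "\<And>s. s \<in> ball 0 R \<Longrightarrow> ?f s = s ^ n * g s" "\<And>s. s \<in> ball 0 R \<Longrightarrow> norm (g s) \<le> B" by blast
  have "(g \<longlongrightarrow> g 0) (at 0)"
    using holomorphic_on_imp_continuous_on[OF g(1)] R(1)
    by (metis centre_in_ball continuous_on_eq_continuous_at isContD open_ball)
  moreover have "\<forall>\<^sub>F s in at 0. s \<in> ball 0 R - {0}"
    using R(1) by (intro eventually_at_in_open) auto
  then have "\<forall>\<^sub>F s in at 0. ?f s / s ^ n = g s"
    by (rule eventually_mono) (use g(2) in auto)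
  with lim have "(g \<longlongrightarrow> 0) (at 0)"
    by (rule Lim_transform_eventually)
  ultimately have g0: "g 0 = 0" using LIM_unique by blast
  let ?s = "of_real (ynorm p) :: complex"
  have s: "?s \<in> ball 0 R" using R \<mu> by simp
  have "norm (g ?s) \<le> B * norm ?s / R" by (rule Schwarz_bound[OF g(1,3) g0 s])
  moreover have "?f ?s = E i p"
  proof -
    have "vector [x, ?s * u, ?s * v] = p"
      using p \<mu> by (simp add: vec_eq_iff forall_3 u_def v_def)
    then show ?thesis by simp
  qed
  ultimately have E: "E i p = ?s ^ n * g ?s" and g': "norm (g ?s) \<le> B * ynorm p / R"
    using g(2)[OF s] \<mu> by simp_all
  have "norm (E i p) = ynorm p ^ n * norm (g ?s)"
    unfolding E norm_mult norm_power using \<mu> by simp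
  also have "\<dots> \<le> ynorm p ^ n * (B * ynorm p / R)"
    using g' \<mu> by (intro mult_left_mono) auto
  finally show ?thesis by (simp add: algebra_simps)
qed

section \<open>Vanishing on the axis y = 0\<close>

lemma vector_axis_in_N: "x \<in> S \<Longrightarrow> vector [x, 0, 0] \<in> N"
  using r_pos by (simp add: N_iff ynorm_def)

lemma norm_E_axis: "x \<in> S \<Longrightarrow> norm (E i (vector [x, 0, 0])) \<le> C * (norm x)\<^sup>2"
  using norm_E_le[OF vector_axis_in_N, of x i] by (simp add: ynorm_def)

text \<open>On the axis the terms that differentiate E in y drop out. What remains couples E 2 and E
  3 through \<open>c i\<close>, but is linear in E i once that factor is regarded as a
  coefficient.\<close>

lemma has_field_derivative_E_axis:
  assumes x: "x \<in> S" and i: "i \<noteq> 1"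
  shows "((\<lambda>x. E i (vector [x, 0, 0])) has_field_derivative
    (m i + a i * x + c i (E 2 (vector [x, 0, 0]) * E 3 (vector [x, 0, 0]))) / x\<^sup>2 * E i (vector [x, 0, 0])) (at x)"
proof -
  let ?p = "vector [x, 0, 0] :: complex ^ 3"
  have i': "i = 2 \<or> i = 3" using exhaust_3[of i] i by auto
  obtain A :: "complex ^ 3" where A: "(E i has_derivative (\<lambda>v. \<Sum>j\<in>UNIV. A $ j * v $ j)) (at ?p)"
    "A $ 1 * (?p $ 1)\<^sup>2 + (\<Sum>j\<in>{2,3}. A $ j * ((m j + a j * ?p $ 1) * ?p $ j)) =
      (m i + a i * ?p $ 1) * E i ?p
      + (c i (U ?p $ 2 * U ?p $ 3) - c i (?p $ 2 * ?p $ 3)) * U ?p $ i + c i (?p $ 2 * ?p $ 3) * E i ?p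
      - (\<Sum>j\<in>{2,3}. A $ j * c j (?p $ 2 * ?p $ 3) * ?p $ j)"
    using E_differentiable[OF vector_axis_in_N[OF x] i] by blast
  have U: "U ?p $ 2 = E 2 ?p" "U ?p $ 3 = E 3 ?p" by (simp_all add: E_def)
  have "A $ 1 * x\<^sup>2 = (m i + a i * x + c i (E 2 ?p * E 3 ?p)) * E i ?p"
    using A(2) i' c_0 by (elim disjE) (simp_all add: U algebra_simps)
  then have "A $ 1 * 1 + A $ 2 * 0 + A $ 3 * 0 = (m i + a i * x + c i (E 2 ?p * E 3 ?p)) / x\<^sup>2 * E i ?p"
    using S_norm[OF x] by (simp add: field_simps)
  then show ?thesis
    using chain_vector_3[where x = "\<lambda>x. x" and y = "\<lambda>_. 0" and z = "\<lambda>_. 0" and t = x and T = UNIV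
        and x' = 1 and y' = 0 and z' = 0, OF A(1)] by simp
qed

abbreviation g :: "3 \<Rightarrow> complex \<Rightarrow> complex" where
  "g i \<equiv> rate d (m i) (a i)"

lemma has_field_derivative_g:
  "x \<in> S \<Longrightarrow> (g i has_field_derivative (m i + a i * x) / x\<^sup>2 * g i x) (at x)"
  using sector_not_nonpos[OF _ \<epsilon>(2) d_nonzero] d_nonzero by (intro has_field_derivative_rate) auto

lemma ratio_squared: "(l / d) * (l / d) = - 1"
  using d_square d_nonzero l_nonzero by (simp add: field_simps power2_eq_square)

text \<open>For q = l / d, which is i or -i, the directions d (1 + q) and d (1 - q) lie at angle pi
  / 4 from d, and on the appropriate one m i / w has real part -1/2, so that \<open>g i\<close>
  explodes along t w as t tends to 0.\<close>

lemma decaying_direction: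
  assumes "i \<noteq> 1"
  obtains w where "w \<noteq> 0" "\<bar>Arg (w / d)\<bar> < pi / 2" "Re (m i / w) < 0"
proof -
  define q where "q = l / d"
  have qq: "q * q = -1" unfolding q_def by (rule ratio_squared)
  have "Re q * Re q - Im q * Im q = -1" "Re q * Im q = 0"
    using arg_cong[OF qq, of Re] arg_cong[OF qq, of Im] by auto
  then have q: "Re q = 0" by (auto) (smt (verit) zero_le_mult_iff)
  then have qi: "Im q * Im q = 1" using \<open>Re q * Re q - Im q * Im q = -1\<close> by simp
  have pos: "\<bar>Arg z\<bar> < pi / 2" if "Re z > 0" for z
    using that Re_Ln_pos_lt[of z] Arg_eq_Im_Ln[of z] by fastforce
  have l: "l = q * d" using d_nonzero by (simp add: q_def)
  have i: "i = 2 \<or> i = 3" using exhaust_3[of i] assms by auto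
  have ne: "1 + q \<noteq> 0" "1 - q \<noteq> 0" using q by (auto simp: complex_eq_iff)
  have *: "q / (1 + q) = (1 + q) / 2" "q / (1 - q) = (q - 1) / 2"
    using ne qq by (auto simp: field_simps)
  show ?thesis
  proof (cases "i = 2")
    case True
    have "m i / (d * (1 + q)) = - (q / (1 + q))" using True m l d_nonzero by (simp add: mult.commute[of q])
    then have "Re (m i / (d * (1 + q))) < 0" using q by (simp only: *) simp
    moreover have "d * (1 + q) / d = 1 + q" using d_nonzero by simp
    ultimately show ?thesis using that[of "d * (1 + q)"] ne d_nonzero pos[of "1 + q"] q by simp
  next
    case False
    have "m i / (d * (1 - q)) = q / (1 - q)" using False i m l d_nonzero by (simp add: mult.commute[of q])
    then have "Re (m i / (d * (1 - q))) < 0" using q by (simp only: *) simp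
    moreover have "d * (1 - q) / d = 1 - q" using d_nonzero by simp
    ultimately show ?thesis using that[of "d * (1 - q)"] ne d_nonzero pos[of "1 - q"] q by simp
  qed
qed

text \<open>Along a ray on which \<open>g i\<close> explodes, the quotient \<open>E i / g i\<close> tends to \<open>0\<close>; since its
  logarithmic derivative is bounded, it vanishes.\<close>

lemma E_axis_eq_0:
  assumes x: "x \<in> S" and i: "i \<noteq> 1"
  shows "E i (vector [x, 0, 0]) = 0"
proof -
  obtain w where w: "w \<noteq> 0" "\<bar>Arg (w / d)\<bar> < pi / 2" "Re (m i / w) < 0"
    using decaying_direction[OF i] .
  define h where "h = (\<lambda>x. E i (vector [x, 0, 0]) / g i x)"
  define e where "e = (\<lambda>x. c i (E 2 (vector [x, 0, 0]) * E 3 (vector [x, 0, 0])) / x\<^sup>2)"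
  \<comment> \<open>By tangency E 2 * E 3 = O(|x|^4) on the axis, so \<open>c i\<close> of it is
    O(|x|^4) too, and \<open>e\<close> stays bounded after division by x^2.\<close>
  define D where "D = L * C\<^sup>2 * r\<^sup>2"
  have h': "(h has_field_derivative e x * h x) (at x)" if "x \<in> S" for x
    unfolding h_def e_def
    by (rule derivative_eq_intros has_field_derivative_E_axis that i has_field_derivative_g refl rate_nonzero)+
      (use S_norm[OF that] in \<open>simp add: divide_simps, simp add: algebra_simps\<close>)
  have e: "norm (e x) \<le> D" if x: "x \<in> S" for x
  proof -
    let ?U = "\<lambda>i. E i (vector [x, 0, 0])"
    have "norm (?U 2 * ?U 3) < \<delta>" "0 < \<delta>"
      using small[OF vector_axis_in_N[OF x]] by (auto simp: E_def)
    then have "norm (c i (?U 2 * ?U 3) - c i 0) \<le> L * norm (?U 2 * ?U 3 - 0)"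
      by (intro c_lipschitz) auto
    also have "\<dots> \<le> L * ((C * (norm x)\<^sup>2) * (C * (norm x)\<^sup>2))"
      using norm_E_axis[OF x] L_nonneg C_nonneg by (auto simp: norm_mult intro!: mult_left_mono mult_mono)
    finally have "norm (c i (?U 2 * ?U 3)) / (norm x)\<^sup>2
        \<le> L * ((C * (norm x)\<^sup>2) * (C * (norm x)\<^sup>2)) / (norm x)\<^sup>2"
      unfolding c_0 diff_zero by (rule divide_right_mono) simp
    then have "norm (e x) \<le> L * ((C * (norm x)\<^sup>2) * (C * (norm x)\<^sup>2)) / (norm x)\<^sup>2"
      by (simp only: e_def norm_divide norm_power)
    also have "\<dots> = L * C\<^sup>2 * (norm x)\<^sup>2" using S_norm[OF x] by (simp add: field_simps power2_eq_square)
    also have "\<dots> \<le> D" unfolding D_def using S_norm[OF x] L_nonneg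
      by (intro mult_left_mono power_mono) auto
    finally show ?thesis .
  qed
  have D: "D \<ge> 0" using L_nonneg by (simp add: D_def)
  have ray: "of_real t * w \<in> S" if "0 < t" "t * norm w < r" for t
  proof -
    have "of_real t * w / d = of_real t * (w / d)" by simp
    then have "Arg (of_real t * w / d) = Arg (w / d)" using that by (simp only: Arg_times_of_real)
    then show ?thesis using that w \<epsilon> by (simp add: sector_def norm_mult)
  qed
  \<comment> \<open>On the ray 1 / |g i| is exp (- \<rho> / t) times a power of t, and E is bounded,
    so h tends to 0 at the vertex whatever the exponent.\<close>
  define \<rho> where "\<rho> = - Re (m i / w)"
  define M where "M = C * r\<^sup>2 * exp (\<bar>Re (a i) * ln (norm (w / d))\<bar> + \<bar>Im (a i) * Arg (w / d)\<bar>)"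
  have "\<rho> > 0" using w(3) by (simp add: \<rho>_def)
  then have "((\<lambda>t. exp (- \<rho> / t - Re (a i) * ln t)) \<longlongrightarrow> 0) (at_right 0)"
    by real_asymp
  then have lim0: "((\<lambda>t. M * exp (- \<rho> / t - Re (a i) * ln t)) \<longlongrightarrow> M * 0) (at_right 0)"
    by (intro tendsto_intros)
  have small_t: "\<forall>\<^sub>F t in at_right 0. 0 < t \<and> t < b" if "b > 0" for b :: real
    using that unfolding eventually_at_right_field by blast
  have h_le: "\<forall>\<^sub>F t in at_right 0. norm (h (of_real t * w)) \<le> M * exp (- \<rho> / t - Re (a i) * ln t)"
    using small_t[of "r / norm w"]
  proof (rule eventually_mono)
    show "r / norm w > 0" using r_pos w by simp
    fix t :: real assume t: "0 < t \<and> t < r / norm w"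
    then have tS: "of_real t * w \<in> S" using w by (intro ray) (auto simp: field_simps)
    let ?x = "of_real t * w"
    have x0: "?x \<noteq> 0" using t w by simp
    have Arg: "Arg (?x / d) = Arg (w / d)"
      using Arg_times_of_real[of t "w / d"] t by simp
    have ln: "ln (norm (?x / d)) = ln t + ln (norm (w / d))"
      using t w d_nonzero ln_mult[of t "norm (w / d)"] by (simp add: norm_mult norm_divide)
    have Re: "Re (- m i / ?x) = \<rho> / t"
    proof -
      have "- m i / ?x = - (m i / w) / of_real t" using t w by (simp add: field_simps)
      then show ?thesis unfolding \<rho>_def by (simp only: Re_divide_of_real uminus_complex.sel)
    qed
    have nr: "norm (g i ?x) = exp (\<rho> / t + Re (a i) * (ln t + ln (norm (w / d))) - Im (a i) * Arg (w / d))"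
      using norm_rate[OF x0 d_nonzero, of "m i" "a i"] unfolding Arg ln Re .
    have "norm (h ?x) = norm (E i (vector [?x, 0, 0])) / norm (g i ?x)"
      by (simp only: h_def norm_divide)
    also have "\<dots> = norm (E i (vector [?x, 0, 0])) *
        exp (- (\<rho> / t + Re (a i) * (ln t + ln (norm (w / d))) - Im (a i) * Arg (w / d)))"
      unfolding nr by (simp only: exp_minus divide_inverse)
    also have "\<dots> \<le> (C * r\<^sup>2) * exp ((\<bar>Re (a i) * ln (norm (w / d))\<bar> + \<bar>Im (a i) * Arg (w / d)\<bar>)
        + (- \<rho> / t - Re (a i) * ln t))"
    proof (intro mult_mono)
      have "norm (E i (vector [?x, 0, 0])) \<le> C * (norm ?x)\<^sup>2" by (rule norm_E_axis[OF tS])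
      also have "\<dots> \<le> C * r\<^sup>2" using S_norm[OF tS] C_nonneg by (intro mult_left_mono power_mono) auto
      finally show "norm (E i (vector [?x, 0, 0])) \<le> C * r\<^sup>2" .
      show "exp (- (\<rho> / t + Re (a i) * (ln t + ln (norm (w / d))) - Im (a i) * Arg (w / d)))
        \<le> exp ((\<bar>Re (a i) * ln (norm (w / d))\<bar> + \<bar>Im (a i) * Arg (w / d)\<bar>) + (- \<rho> / t - Re (a i) * ln t))"
        unfolding exp_le_cancel_iff distrib_left by linarith
    qed (use C_nonneg in auto)
    also have "\<dots> = M * exp (- \<rho> / t - Re (a i) * ln t)"
      unfolding M_def exp_add by simp
    finally show "norm (h ?x) \<le> M * exp (- \<rho> / t - Re (a i) * ln t)" .
  qed
  have lim: "((\<lambda>t. h (of_real t * w)) \<longlongrightarrow> 0) (at_right 0)"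
    using lim0 by (intro Lim_null_comparison[OF h_le]) simp
  then have "\<forall>\<^sub>F t in at_right 0. norm (h (of_real t * w)) < 1"
    using tendstoD[OF lim, of 1] by simp
  then obtain b where b: "b > 0" "\<And>t. 0 < t \<Longrightarrow> t < b \<Longrightarrow> norm (h (of_real t * w)) < 1"
    unfolding eventually_at_right_field by auto
  \<comment> \<open>The last entry makes D T |w| at most 1/2, the contraction factor below; the
    others keep |h| < 1 and the segment inside \<open>S\<close>.\<close>
  define T where "T = min (b / 2) (min (r / (2 * norm w)) (1 / (2 * (D + 1) * norm w)))"
  have T: "0 < T" "T < b" "T * norm w < r" "D * (T * norm w) \<le> 1 / 2"
  proof -
    show "0 < T" "T < b" using b r_pos w D by (auto simp: T_def)
    have "T * norm w \<le> r / (2 * norm w) * norm w" unfolding T_def by (intro mult_right_mono) auto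
    also have "\<dots> < r" using r_pos w by simp
    finally show "T * norm w < r" .
    have "T * norm w \<le> 1 / (2 * (D + 1) * norm w) * norm w" unfolding T_def by (intro mult_right_mono) auto
    also have "\<dots> = 1 / (2 * (D + 1))" using w by simp
    finally have "D * (T * norm w) \<le> D * (1 / (2 * (D + 1)))" using D by (rule mult_left_mono)
    also have "\<dots> \<le> 1 / 2" using D by (simp add: field_simps)
    finally show "D * (T * norm w) \<le> 1 / 2" .
  qed
  let ?R = "(\<lambda>t. of_real t * w) ` {0<..T}"
  have RS: "?R \<subseteq> S"
  proof safe
    fix t assume "t \<in> {0<..T}"
    then have "0 < t" "t * norm w < r"
      using T(3) mult_right_mono[of t T "norm w"] by auto
    then show "of_real t * w \<in> S" by (rule ray)
  qed
  have convR: "convex ?R"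
    by (intro convex_linear_image) (auto intro!: linearI simp: algebra_simps scaleR_conv_of_real)
  \<comment> \<open>The mean value inequality between s w and t w, with s tending to 0 where h has
    limit 0, multiplies the bound by D T |w| \<le> 1/2 each time.\<close>
  have bound: "\<forall>t\<in>{0<..T}. norm (h (of_real t * w)) \<le> (1/2) ^ k" for k
  proof (induction k)
    case 0
    then show ?case using b T by (auto intro: less_imp_le)
  next
    case (Suc k)
    show ?case
    proof
      fix t assume t: "t \<in> {0<..T}"
      have "norm (h (of_real t * w) - h (of_real s * w)) \<le> (1/2) ^ Suc k" if s: "s \<in> {0<..T}" for s
      proof -
        have "norm (h (of_real t * w) - h (of_real s * w)) \<le>
            (D * (1/2) ^ k) * norm (of_real t * w - of_real s * w)"
        proof (rule field_differentiable_bound[OF convR])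
          fix z assume z: "z \<in> ?R"
          show "(h has_field_derivative e z * h z) (at z within ?R)"
            using h' z RS by (blast intro: has_field_derivative_at_within)
          show "norm (e z * h z) \<le> D * (1/2) ^ k"
            using e[of z] Suc.IH z RS D unfolding norm_mult by (intro mult_mono) auto
        qed (use s t in auto)
        also have "\<dots> \<le> (D * (1/2) ^ k) * (T * norm w)"
        proof -
          have "of_real t * w - of_real s * w = of_real (t - s) * w" by (simp add: algebra_simps)
          then have "norm (of_real t * w - of_real s * w) = \<bar>t - s\<bar> * norm w"
            by (simp only: norm_mult norm_of_real)
          also have "\<dots> \<le> T * norm w" using s t by (intro mult_right_mono) auto
          finally show ?thesis using D by (intro mult_left_mono) auto
        qed
        also have "\<dots> = (D * (T * norm w)) * (1/2) ^ k" by simp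
        also have "\<dots> \<le> 1/2 * (1/2) ^ k" using T(4) by (intro mult_right_mono) auto
        finally show ?thesis by simp
      qed
      then have "\<forall>\<^sub>F s in at_right 0. norm (h (of_real t * w) - h (of_real s * w)) \<le> (1/2) ^ Suc k"
        using small_t[OF T(1)] by (elim eventually_mono) auto
      moreover have "((\<lambda>s. norm (h (of_real t * w) - h (of_real s * w))) \<longlongrightarrow> norm (h (of_real t * w) - 0)) (at_right 0)"
        by (intro tendsto_intros lim)
      ultimately have "norm (h (of_real t * w) - 0) \<le> (1/2) ^ Suc k"
        by (intro tendsto_upperbound) auto
      then show "norm (h (of_real t * w)) \<le> (1/2) ^ Suc k" by simp
    qed
  qed
  have zero: "E i (vector [z, 0, 0]) = 0" if z: "z \<in> ?R" for z
  proof -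
    obtain t where t: "t \<in> {0<..T}" "z = of_real t * w" using z by auto
    have "(\<lambda>k. (1/2) ^ k) \<longlonglongrightarrow> (0::real)" by (rule LIMSEQ_realpow_zero) auto
    then have "norm (h z) \<le> 0"
      by (rule LIMSEQ_le_const) (use bound t in blast)
    then show ?thesis by (simp add: h_def)
  qed
  have TR: "of_real T * w \<in> ?R" "of_real (T / 2) * w \<in> ?R"
    using T by (intro imageI; simp)+
  show ?thesis
  \<comment> \<open>So far the zeros fill only a segment; the identity theorem spreads them over the
    connected sector.\<close>
  proof (rule analytic_continuation[where U = "?R" and \<xi> = "of_real T * w" and S = S and w = x])
    show "(\<lambda>x. E i (vector [x, 0, 0])) holomorphic_on S"
      using has_field_derivative_E_axis[OF _ i] open_sector[OF d_nonzero \<epsilon>(2)]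
      by (auto simp: holomorphic_on_open)
    show "open S" by (rule open_sector[OF d_nonzero \<epsilon>(2)])
    show "connected S" by (rule connected_sector[OF d_nonzero r_pos \<epsilon>(2)])
    show "of_real T * w \<in> S" using RS TR(1) by (rule subsetD)
    have "of_real T * w \<noteq> of_real (T / 2) * w" using T w by simp
    then have "\<nexists>x. ?R = {x}" using TR by (metis singletonD)
    then show "of_real T * w islimpt ?R"
      using connected_imp_perfect[OF convex_connected[OF convR] TR(1)] by blast
  qed (fact RS zero x)+
qed

text \<open>The hypothesis of \<open>norm_E_le_Schwarz\<close> for n = 0; hence the division by
  \<open>s ^ 0\<close>.\<close>

lemma E_line_tendsto_0:
  assumes x: "x \<in> S" and i: "i \<noteq> 1"
  shows "((\<lambda>s. E i (vector [x, s * u, s * v]) / s ^ 0) \<longlongrightarrow> 0) (at 0)"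
proof -
  have "(\<lambda>s. E i (vector [x, s * u, s * v])) holomorphic_on ball 0 (r / (max (norm u) (norm v) + 1))"
    by (rule E_line_holomorphic[OF x i]) (auto simp: add_nonneg_pos le_max_iff_disj)
  then have "isCont (\<lambda>s. E i (vector [x, s * u, s * v])) 0"
    using r_pos by (intro continuous_on_interior[OF holomorphic_on_imp_continuous_on])
      (auto simp: interior_open add_nonneg_pos le_max_iff_disj)
  then show ?thesis by (simp add: isCont_def E_axis_eq_0[OF x i])
qed

lemma small_order_1: "small_order 1"
  unfolding small_order_def
proof (intro ballI allI impI)
  fix p and i :: 3 assume p: "p \<in> N" and i: "i \<noteq> 1"
  have x: "p $ 1 \<in> S" using p by (simp add: N_iff)
  have "norm (E i p) \<le> K * ynorm p ^ Suc 0 / r"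
  proof (rule norm_E_le_Schwarz[OF x i E_line_tendsto_0[OF x i] E_axis_eq_0[OF x i] p refl r_pos order_refl])
    show "ynorm p < r" using p by (simp add: N_iff)
    show "norm (E i p) \<le> K * ynorm p ^ 0" if "p \<in> N" for p
      using small_order_0 that i by (simp add: small_order_def)
  qed
  then show "norm (E i p) \<le> K * (ynorm p / r) ^ 1" by simp
qed

text \<open>Where |y| < |x|, tangency gives E = O(|x|^2), and the Schwarz lemma on the disc of
  radius |x| trades one |x| for |y|. The factor |x| that remains settles the case n = 1
  later.\<close>

lemma E_linear_small:
  assumes p: "p \<in> N" "ynorm p < norm (p $ 1)" and i: "i \<noteq> 1"
  shows "norm (E i p) \<le> 9 * C * norm (p $ 1) * ynorm p"
proof -
  have x: "p $ 1 \<in> S" using p by (simp add: N_iff)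
  let ?x = "p $ 1"
  have "norm (E i p) \<le> (9 * C * (norm ?x)\<^sup>2) * ynorm p ^ Suc 0 / norm ?x"
  proof (rule norm_E_le_Schwarz[OF x i E_line_tendsto_0[OF x i] E_axis_eq_0[OF x i] p(1) refl _ _ p(2)])
    show "norm ?x > 0" "norm ?x \<le> r" using S_norm[OF x] by auto
    show "norm (E i p') \<le> (9 * C * (norm ?x)\<^sup>2) * ynorm p' ^ 0"
      if p': "p' \<in> N" "p' $ 1 = ?x" "ynorm p' < norm ?x" for p'
    proof -
      have "norm (E i p') \<le> C * (norm (p' $ 1) + 2 * ynorm p')\<^sup>2" by (rule norm_E_le[OF p'(1)])
      also have "\<dots> \<le> C * (3 * norm ?x)\<^sup>2"
        using p' ynorm_nonneg[of p'] C_nonneg by (intro mult_left_mono power_mono) auto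
      finally show ?thesis by (simp add: power_mult_distrib)
    qed
  qed
  then show ?thesis using S_norm[OF x] by (simp add: power2_eq_square)
qed

section \<open>Transport along the linear part of Z\<close>

definition Q :: real where
  "Q = L * K * ((2 + K / r) * (1 + K / r) + 3)"

text \<open>The remainder gains two orders because c (y1 y2) = O(|y|^2). The derivatives of E are
  estimated by Cauchy on discs of radius \<open>ynorm p\<close> about p, where \<open>ynorm\<close>
  at most doubles; hence the 2 in the bound and the hypothesis
  \<open>ynorm p < r / 2\<close>.\<close>

lemma E_transport:
  assumes ord: "small_order n" "n \<ge> 1" and p: "p \<in> N" "ynorm p < r / 2" and i: "i \<noteq> 1"
  obtains A :: "complex ^ 3" and \<rho> where "(E i has_derivative (\<lambda>v. \<Sum>j\<in>UNIV. A $ j * v $ j)) (at p)"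
    "A $ 1 * (p $ 1)\<^sup>2 + (\<Sum>j\<in>{2,3}. A $ j * ((m j + a j * p $ 1) * p $ j)) = (m i + a i * p $ 1) * E i p + \<rho>"
    "norm \<rho> \<le> Q * (2 * ynorm p / r) ^ n * (ynorm p)\<^sup>2"
proof -
  define \<mu> where "\<mu> = ynorm p"
  define P where "P = (2 * \<mu> / r) ^ n"
  define v where "v = p $ 2 * p $ 3"
  define vU where "vU = U p $ 2 * U p $ 3"
  obtain A :: "complex ^ 3" where A: "(E i has_derivative (\<lambda>v. \<Sum>j\<in>UNIV. A $ j * v $ j)) (at p)"
    "A $ 1 * (p $ 1)\<^sup>2 + (\<Sum>j\<in>{2,3}. A $ j * ((m j + a j * p $ 1) * p $ j)) =
      (m i + a i * p $ 1) * E i p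
      + (c i vU - c i v) * U p $ i + c i v * E i p - (\<Sum>j\<in>{2,3}. A $ j * c j v * p $ j)"
    using E_differentiable[OF p(1) i] unfolding v_def vU_def by blast
  define \<rho> where "\<rho> = (c i vU - c i v) * U p $ i + c i v * E i p - (\<Sum>j\<in>{2,3}. A $ j * c j v * p $ j)"
  have \<mu>: "\<mu> \<ge> 0" "\<mu> < r" "\<mu> \<le> 2 * \<mu>" using ynorm_nonneg[of p] p r_pos by (auto simp: \<mu>_def)
  have P: "P \<ge> 0" using \<mu> r_pos by (simp add: P_def)
  have Kr: "K / r \<ge> 0" using K_nonneg r_pos by simp
  have E: "norm (E j q) \<le> K * P" if "q \<in> N" "ynorm q \<le> 2 * \<mu>" "j \<noteq> 1" for j q
  proof -
    have "norm (E j q) \<le> K * (ynorm q / r) ^ n" using ord that by (simp add: small_order_def)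
    also have "\<dots> \<le> K * P" unfolding P_def
      using K_nonneg that r_pos ynorm_nonneg[of q] by (intro mult_left_mono power_mono divide_right_mono) auto
    finally show ?thesis .
  qed
  have Ep: "norm (E j p) \<le> K * P" if "j \<noteq> 1" for j
    using E[OF p(1) _ that] \<mu> by (simp add: \<mu>_def)
  \<comment> \<open>In U = y + E only the first-order bound of E is used, so that U is O(\<mu>) with
    a constant independent of n.\<close>
  have Ep': "norm (E j p) \<le> K / r * \<mu>" if "j \<noteq> 1" for j
    using small_order_1 p(1) that by (simp add: small_order_def \<mu>_def)
  have pj: "norm (p $ j) \<le> \<mu>" if "j \<noteq> 1" for j
    using exhaust_3[of j] that by (auto simp: \<mu>_def ynorm_def)
  have Uj: "norm (U p $ j) \<le> (1 + K / r) * \<mu>" if "j \<noteq> 1" for j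
  proof -
    have "U p $ j = p $ j + E j p" by (simp add: E_def)
    then have "norm (U p $ j) \<le> norm (p $ j) + norm (E j p)" by (metis norm_triangle_ineq)
    then show ?thesis using pj[OF that] Ep'[OF that] by (simp add: distrib_right)
  qed
  have [simp]: "(2::3) \<noteq> 1" "(3::3) \<noteq> 1" by auto
  have vU: "norm (vU - v) \<le> K * P * ((2 + K / r) * \<mu>)"
  proof -
    have "vU - v = E 2 p * U p $ 3 + p $ 2 * E 3 p" by (simp add: E_def v_def vU_def algebra_simps)
    then have "norm (vU - v) \<le> norm (E 2 p) * norm (U p $ 3) + norm (p $ 2) * norm (E 3 p)"
      by (metis norm_mult norm_triangle_ineq)
    also have "\<dots> \<le> (K * P) * ((1 + K / r) * \<mu>) + \<mu> * (K * P)"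
      using K_nonneg P \<mu> Kr by (intro add_mono mult_mono Ep Uj pj) auto
    finally show ?thesis by (simp add: algebra_simps)
  qed
  have \<delta>: "norm v < \<delta>" "norm vU < \<delta>" using small[OF p(1)] by (auto simp: v_def vU_def)
  have cv: "norm (c j v) \<le> L * (\<mu> * \<mu>)" for j
  proof -
    have "norm (c j v - c j 0) \<le> L * norm (v - 0)" using \<delta>(1) norm_ge_zero[of v]
      by (intro c_lipschitz) (auto simp del: norm_ge_zero)
    also have "\<dots> \<le> L * (\<mu> * \<mu>)" unfolding v_def
      using L_nonneg \<mu> by (auto simp: norm_mult intro!: mult_left_mono mult_mono pj)
    finally show ?thesis by (simp add: c_0)
  qed
  have 1: "norm ((c i vU - c i v) * U p $ i) \<le> (L * (K * P * ((2 + K / r) * \<mu>))) * ((1 + K / r) * \<mu>)"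
    unfolding norm_mult
  proof (intro mult_mono Uj i)
    have "norm (c i vU - c i v) \<le> L * norm (vU - v)" using \<delta> by (intro c_lipschitz)
    also have "\<dots> \<le> L * (K * P * ((2 + K / r) * \<mu>))" using vU L_nonneg by (rule mult_left_mono)
    finally show "norm (c i vU - c i v) \<le> L * (K * P * ((2 + K / r) * \<mu>))" .
  qed (use L_nonneg K_nonneg P Kr \<mu> in auto)
  have 2: "norm (c i v * E i p) \<le> (L * (\<mu> * \<mu>)) * (K * P)"
    unfolding norm_mult using L_nonneg \<mu> by (intro mult_mono cv Ep i) auto
  \<comment> \<open>The Cauchy inequality loses a factor \<mu>, which \<open>p $ j\<close> restores
    in the term \<open>A $ j * c j v * p $ j\<close>.\<close>
  have A_bound: "norm (A $ j) * \<mu> \<le> K * P" if j: "j = 2 \<or> j = 3" for j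
  proof (cases "\<mu> = 0")
    case True
    then show ?thesis using K_nonneg P by simp
  next
    case False
    then have \<mu>0: "\<mu> > 0" using \<mu> by simp
    \<comment> \<open>\<open>b\<close> is the unit vector of the direction j, so that one curve
      serves for both coordinates.\<close>
    define b where "b k = (if j = k then 1 else 0 :: complex)" for k
    let ?f = "\<lambda>t. E i (vector [p $ 1, p $ 2 + t * b 2, p $ 3 + t * b 3])"
    have inN: "vector [p $ 1, p $ 2 + t * b 2, p $ 3 + t * b 3] \<in> N"
      "ynorm (vector [p $ 1, p $ 2 + t * b 2, p $ 3 + t * b 3]) \<le> 2 * \<mu>" if "norm t \<le> \<mu>" for t
    proof -
      have "norm (p $ k + t * b k) \<le> 2 * \<mu>" if "k \<noteq> 1" for k
        using pj[OF that] \<open>norm t \<le> \<mu>\<close> \<mu> norm_triangle_ineq[of "p $ k" t] by (auto simp: b_def)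
      then show *: "ynorm (vector [p $ 1, p $ 2 + t * b 2, p $ 3 + t * b 3]) \<le> 2 * \<mu>"
        by (simp add: ynorm_def)
      then show "vector [p $ 1, p $ 2 + t * b 2, p $ 3 + t * b 3] \<in> N"
        using p by (simp add: N_iff \<mu>_def)
    qed
    have D: "\<exists>f'. (?f has_field_derivative f') (at t)" if t: "norm t \<le> \<mu>" for t
    proof -
      obtain B :: "complex ^ 3" where "(E i has_derivative (\<lambda>v. \<Sum>j\<in>UNIV. B $ j * v $ j))
          (at (vector [p $ 1, p $ 2 + t * b 2, p $ 3 + t * b 3]))"
        using E_differentiable[OF inN(1)[OF t] i] by blast
      then have "(?f has_field_derivative B $ 1 * 0 + B $ 2 * b 2 + B $ 3 * b 3) (at t)"
        by (rule chain_vector_3) (auto intro!: derivative_eq_intros)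
      then show ?thesis by blast
    qed
    have "norm ((deriv ^^ 1) ?f 0) \<le> fact 1 * (K * P) / \<mu> ^ 1"
    proof (rule Cauchy_inequality)
      show "?f holomorphic_on ball 0 \<mu>"
        using D by (auto simp: holomorphic_on_open)
      show "continuous_on (cball 0 \<mu>) ?f"
      proof (intro continuous_at_imp_continuous_on ballI)
        fix t assume "t \<in> cball (0 :: complex) \<mu>"
        then have "norm t \<le> \<mu>" by simp
        from D[OF this] show "isCont ?f t" by (blast intro: DERIV_isCont)
      qed
      show "norm (?f t) \<le> K * P" if "norm (0 - t) = \<mu>" for t
      proof -
        have "norm t \<le> \<mu>" using that by simp
        from inN[OF this] show ?thesis using i by (rule E)
      qed
    qed (rule \<mu>0)
    moreover have "(?f has_field_derivative A $ 1 * 0 + A $ 2 * b 2 + A $ 3 * b 3) (at 0)"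
    proof -
      have "vector [p $ 1, p $ 2 + 0 * b 2, p $ 3 + 0 * b 3] = p"
        by (simp add: vec_eq_iff forall_3)
      then have "(E i has_derivative (\<lambda>v. \<Sum>j\<in>UNIV. A $ j * v $ j))
          (at (vector [p $ 1, p $ 2 + 0 * b 2, p $ 3 + 0 * b 3]))" using A(1) by simp
      then show ?thesis
        by (rule chain_vector_3[where t = 0 and x = "\<lambda>_. p $ 1" and y = "\<lambda>t. p $ 2 + t * b 2"
            and z = "\<lambda>t. p $ 3 + t * b 3"]) (auto intro!: derivative_eq_intros)
    qed
    then have "deriv ?f 0 = A $ j" using j by (auto simp: b_def dest!: DERIV_imp_deriv)
    ultimately show ?thesis using \<mu>0 by (simp add: field_simps)
  qed
  have 3: "norm (A $ j * c j v * p $ j) \<le> K * P * (L * (\<mu> * \<mu>))" if j: "j = 2 \<or> j = 3" for j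
  proof -
    have "norm (A $ j * c j v * p $ j) \<le> norm (A $ j) * (L * (\<mu> * \<mu>)) * \<mu>"
      unfolding norm_mult using j L_nonneg \<mu> by (intro mult_mono cv pj) auto
    also have "\<dots> = (norm (A $ j) * \<mu>) * (L * (\<mu> * \<mu>))" by simp
    also have "\<dots> \<le> K * P * (L * (\<mu> * \<mu>))" using A_bound[OF j] L_nonneg \<mu> by (intro mult_right_mono) auto
    finally show ?thesis .
  qed
  have "norm \<rho> \<le> norm ((c i vU - c i v) * U p $ i) + norm (c i v * E i p)
      + (norm (A $ 2 * c 2 v * p $ 2) + norm (A $ 3 * c 3 v * p $ 3))"
    unfolding \<rho>_def
    by (intro norm_triangle_le_diff add_mono norm_triangle_ineq) (auto intro: norm_triangle_ineq)
  also have "\<dots> \<le> (L * (K * P * ((2 + K / r) * \<mu>))) * ((1 + K / r) * \<mu>) + (L * (\<mu> * \<mu>)) * (K * P)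
      + (K * P * (L * (\<mu> * \<mu>)) + K * P * (L * (\<mu> * \<mu>)))"
    by (intro add_mono 1 2 3) auto
  \<comment> \<open>Here \<open>Q\<close> gets its shape: (2 + K / r) (1 + K / r) comes from the
    change of \<open>c\<close>, and 1 each from the product of \<open>c\<close> with E and from the
    two derivative terms.\<close>
  also have "\<dots> = Q * P * \<mu>\<^sup>2"
  proof -
    have "(L * (K * P * ((2 + k) * \<mu>))) * ((1 + k) * \<mu>) + (L * (\<mu> * \<mu>)) * (K * P)
        + (K * P * (L * (\<mu> * \<mu>)) + K * P * (L * (\<mu> * \<mu>)))
        = L * K * ((2 + k) * (1 + k) + 3) * P * \<mu>\<^sup>2" for k
      by (simp add: power2_eq_square algebra_simps)
    then show ?thesis unfolding Q_def .
  qed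
  finally have "norm \<rho> \<le> Q * (2 * ynorm p / r) ^ n * (ynorm p)\<^sup>2"
    by (simp add: P_def \<mu>_def)
  moreover have "A $ 1 * (p $ 1)\<^sup>2 + (\<Sum>j\<in>{2,3}. A $ j * ((m j + a j * p $ 1) * p $ j)) = (m i + a i * p $ 1) * E i p + \<rho>"
    using A(2) by (simp add: \<rho>_def)
  ultimately show ?thesis using A(1) that by blast
qed

text \<open>The limit is the homogeneous part of degree n of E over x, evaluated at (u, v). The disc
  of radius R / (M + 1) also serves when u = v = 0.\<close>

lemma line_limit:
  assumes x: "x \<in> S" and i: "i \<noteq> 1" and R: "0 < R" "R \<le> r"
    and bd: "\<And>p. p \<in> N \<Longrightarrow> p $ 1 = x \<Longrightarrow> ynorm p < R \<Longrightarrow> norm (E i p) \<le> B * ynorm p ^ n"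
  obtains \<kappa> where "((\<lambda>s. E i (vector [x, s * u, s * v]) / s ^ n) \<longlongrightarrow> \<kappa>) (at 0)"
    "norm \<kappa> \<le> B * max (norm u) (norm v) ^ n"
proof -
  define M where "M = max (norm u) (norm v)"
  have M: "M \<ge> 0" by (simp add: M_def le_max_iff_disj)
  let ?f = "\<lambda>s. E i (vector [x, s * u, s * v])"
  let ?b = "ball 0 (R / (M + 1)) :: complex set"
  have R': "R / (M + 1) > 0" using R M by simp
  have "R / (M + 1) \<le> r / (M + 1)" using R M by (intro divide_right_mono) auto
  then have "?b \<subseteq> ball 0 (r / (M + 1))" by (rule subset_ball)
  moreover have "?f holomorphic_on ball 0 (r / (M + 1))"
  proof (rule E_line_holomorphic[OF x i])
    show "max (norm u) (norm v) \<le> M + 1" unfolding M_def by linarith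
    show "0 < M + 1" using M by linarith
  qed
  ultimately have holo: "?f holomorphic_on ?b" using holomorphic_on_subset by blast
  have "norm (?f s) \<le> (B * M ^ n) * norm s ^ n" if s: "s \<in> ?b" for s
  proof -
    have "norm s * M \<le> norm s * (M + 1)" by (intro mult_left_mono) auto
    also have "\<dots> < R" using s M by (simp add: pos_less_divide_eq)
    finally have "ynorm (vector [x, s * u, s * v]) < R" by (simp only: ynorm_vector M_def)
    then have "norm (?f s) \<le> B * ynorm (vector [x, s * u, s * v]) ^ n"
      using x R by (intro bd) (simp_all add: N_iff)
    then show ?thesis by (simp only: ynorm_vector M_def[symmetric] power_mult_distrib mult_ac)
  qed
  from factor_power[OF holo R' this] obtain h where h: "h holomorphic_on ?b"
    "\<And>s. s \<in> ?b \<Longrightarrow> ?f s = s ^ n * h s" "\<And>s. s \<in> ?b \<Longrightarrow> norm (h s) \<le> B * M ^ n" by blast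
  have "(h \<longlongrightarrow> h 0) (at 0)"
    using holomorphic_on_imp_continuous_on[OF h(1)] R'
    by (metis centre_in_ball continuous_on_eq_continuous_at isContD open_ball)
  moreover have "\<forall>\<^sub>F s in at 0. s \<in> ?b - {0}"
    using R' by (intro eventually_at_in_open) auto
  then have "\<forall>\<^sub>F s in at 0. h s = ?f s / s ^ n"
    by (rule eventually_mono) (use h(2) in auto)
  ultimately have "((\<lambda>s. ?f s / s ^ n) \<longlongrightarrow> h 0) (at 0)"
    by (rule Lim_transform_eventually)
  moreover have "norm (h 0) \<le> B * M ^ n" using h(3)[of 0] R' by simp
  ultimately show ?thesis using that by (simp add: M_def)
qed

text \<open>The curve (x, s u g 2, s v g 3) solves the linear part of Z, so along it the quotient of
  E i by g i moves only through the remainder of \<open>E_transport\<close>, which is O(|s|^(n +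
  2)).\<close>

lemma transport_along_rates:
  assumes ord: "small_order n" "n \<ge> 1" and i: "i \<noteq> 1" and x: "x \<in> S"
    and y: "norm s * max (norm (u * g 2 x)) (norm (v * g 3 x)) < r / 2"
  obtains e where "((\<lambda>x. E i (vector [x, s * (u * g 2 x), s * (v * g 3 x)]) / g i x) has_field_derivative
      e / (x\<^sup>2 * g i x)) (at x)"
    "norm e \<le> Q * (2 * (norm s * max (norm (u * g 2 x)) (norm (v * g 3 x))) / r) ^ n
      * (norm s * max (norm (u * g 2 x)) (norm (v * g 3 x)))\<^sup>2"
proof -
  let ?p = "vector [x, s * (u * g 2 x), s * (v * g 3 x)] :: complex ^ 3"
  have yp: "ynorm ?p = norm s * max (norm (u * g 2 x)) (norm (v * g 3 x))"
    by (rule ynorm_vector)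
  have p: "?p \<in> N" "ynorm ?p < r / 2" using x y r_pos by (auto simp: N_iff yp)
  obtain A :: "complex ^ 3" and e where A: "(E i has_derivative (\<lambda>v. \<Sum>j\<in>UNIV. A $ j * v $ j)) (at ?p)"
    and eq: "A $ 1 * (?p $ 1)\<^sup>2 + (\<Sum>j\<in>{2,3}. A $ j * ((m j + a j * ?p $ 1) * ?p $ j))
      = (m i + a i * ?p $ 1) * E i ?p + e"
    and e: "norm e \<le> Q * (2 * ynorm ?p / r) ^ n * (ynorm ?p)\<^sup>2"
    using E_transport[OF ord p i] .
  let ?F = "\<lambda>x. E i (vector [x, s * (u * g 2 x), s * (v * g 3 x)])"
  define F' where "F' = A $ 1 * 1 + A $ 2 * (s * (u * ((m 2 + a 2 * x) / x\<^sup>2 * g 2 x)))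
    + A $ 3 * (s * (v * ((m 3 + a 3 * x) / x\<^sup>2 * g 3 x)))"
  have "(?F has_field_derivative F') (at x)"
    unfolding F'_def
    by (rule chain_vector_3[where x = "\<lambda>x. x" and y = "\<lambda>x. s * (u * g 2 x)"
        and z = "\<lambda>x. s * (v * g 3 x)", OF A]) (auto intro!: derivative_eq_intros DERIV_cmult has_field_derivative_g x)
  moreover have x0: "x \<noteq> 0" using S_norm[OF x] by auto
  have "x\<^sup>2 * F' = A $ 1 * (?p $ 1)\<^sup>2 + (\<Sum>j\<in>{2,3}. A $ j * ((m j + a j * ?p $ 1) * ?p $ j))"
    using x0 by (simp add: F'_def field_simps)
  then have "F' = ((m i + a i * x) * ?F x + e) / x\<^sup>2"
    unfolding eq using x0 by (simp add: field_simps)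
  ultimately have F: "(?F has_field_derivative ((m i + a i * x) * ?F x + e) / x\<^sup>2) (at x)" by simp
  have "((\<lambda>x. ?F x / g i x) has_field_derivative e / (x\<^sup>2 * g i x)) (at x)"
    using x0 by (intro DERIV_cong[OF DERIV_divide[OF F has_field_derivative_g[OF x] rate_nonzero]])
      (simp add: divide_simps, simp add: algebra_simps)
  with e that show ?thesis unfolding yp by blast
qed

text \<open>After division by s^n the derivative of the quotient along the curves is still O(|s|^2).
  Its limit for s -> 0 is thus constant, and no differentiability of \<kappa> has to be
  shown.\<close>

lemma limit_over_rate_local_const:
  assumes ord: "small_order n" "n \<ge> 1" and i: "i \<noteq> 1" and x1: "x1 \<in> S"
    and lim: "\<And>x. x \<in> S \<Longrightarrow>
      ((\<lambda>s. E i (vector [x, s * (u * g 2 x), s * (v * g 3 x)]) / s ^ n) \<longlongrightarrow> \<kappa> x) (at 0)"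
  shows "\<forall>\<^sub>F x in at x1 within S. \<kappa> x1 / g i x1 = \<kappa> x / g i x"
proof -
  \<comment> \<open>A compact disc inside the sector bounds the rates and 1 / (x^2 g i), which have
    no uniform bound up to the vertex.\<close>
  obtain b where b: "b > 0" "cball x1 b \<subseteq> S"
    using open_sector[OF d_nonzero \<epsilon>(2), of r] x1 open_contains_cball by metis
  have cont_g: "continuous_on (cball x1 b) (g j)" for j
    using has_field_derivative_g b
    by (intro continuous_at_imp_continuous_on) (blast intro: DERIV_isCont)
  have bounded: "\<exists>M>0. \<forall>x\<in>cball x1 b. norm (h x) \<le> M"
    if "continuous_on (cball x1 b) h" for h :: "complex \<Rightarrow> complex"
    using compact_imp_bounded[OF compact_continuous_image[OF that compact_cball]]
    unfolding bounded_pos by auto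
  have "continuous_on (cball x1 b) (\<lambda>x. u * g 2 x)" by (intro continuous_intros cont_g)
  from bounded[OF this] obtain M2 where M2: "M2 > 0" "\<And>x. x \<in> cball x1 b \<Longrightarrow> norm (u * g 2 x) \<le> M2"
    by blast
  have "continuous_on (cball x1 b) (\<lambda>x. v * g 3 x)" by (intro continuous_intros cont_g)
  from bounded[OF this] obtain M3 where M3: "M3 > 0" "\<And>x. x \<in> cball x1 b \<Longrightarrow> norm (v * g 3 x) \<le> M3"
    by blast
  have S0: "x \<noteq> 0" if "x \<in> cball x1 b" for x using that b S_norm by force
  have "continuous_on (cball x1 b) (\<lambda>x. 1 / (x\<^sup>2 * g i x))" by (intro continuous_intros cont_g) (use S0 in auto)
  from bounded[OF this] obtain M4 where M4: "M4 > 0" "\<And>x. x \<in> cball x1 b \<Longrightarrow> norm (1 / (x\<^sup>2 * g i x)) \<le> M4"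
    by blast
  define M where "M = max M2 M3"
  have M: "M > 0" "\<And>x. x \<in> cball x1 b \<Longrightarrow> max (norm (u * g 2 x)) (norm (v * g 3 x)) \<le> M"
    using M2 M3 by (fastforce simp: M_def max_def)+
  have Q: "Q \<ge> 0" using L_nonneg K_nonneg r_pos by (auto simp: Q_def)
  define B where "B = Q * (2 * M / r) ^ n * M\<^sup>2 * M4"
  let ?F = "\<lambda>s x. E i (vector [x, s * (u * g 2 x), s * (v * g 3 x)])"
  have eq: "\<kappa> x1 / g i x1 = \<kappa> x / g i x" if x: "x \<in> cball x1 b" for x
  proof -
    \<comment> \<open>The condition on s keeps the curves within \<open>ynorm\<close> below r / 2,
      as the transport requires.\<close>
    have key: "norm (?F s x1 / g i x1 - ?F s x / g i x) \<le> B * norm s ^ (n + 2) * norm (x1 - x)"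
      if s: "norm s < r / (2 * M)" for s
    proof -
      have "\<forall>z\<in>cball x1 b. \<exists>D. ((\<lambda>x. ?F s x / g i x) has_field_derivative D) (at z)
          \<and> norm D \<le> B * norm s ^ (n + 2)"
      proof
        fix z assume z: "z \<in> cball x1 b"
        define \<mu> where "\<mu> = norm s * max (norm (u * g 2 z)) (norm (v * g 3 z))"
        have \<mu>0: "0 \<le> \<mu>" by (simp add: \<mu>_def le_max_iff_disj)
        have \<mu>: "\<mu> \<le> norm s * M"
          unfolding \<mu>_def using M(2)[OF z] by (intro mult_left_mono) auto
        also have "\<dots> < r / 2" using s M by (simp add: field_simps)
        finally obtain e where e: "((\<lambda>x. ?F s x / g i x) has_field_derivative e / (z\<^sup>2 * g i z)) (at z)"
          "norm e \<le> Q * (2 * \<mu> / r) ^ n * \<mu>\<^sup>2"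
          using transport_along_rates[OF ord i, of z s u v] b z unfolding \<mu>_def by blast
        have "norm e \<le> Q * (2 * (norm s * M) / r) ^ n * (norm s * M)\<^sup>2"
          using \<mu> \<mu>0 Q M(1) r_pos
          by (intro order_trans[OF e(2)] mult_mono[of "Q * _"] mult_left_mono power_mono divide_right_mono)
            auto
        then have "norm (e * (1 / (z\<^sup>2 * g i z))) \<le> Q * (2 * (norm s * M) / r) ^ n * (norm s * M)\<^sup>2 * M4"
          unfolding norm_mult using M4(2)[OF z] Q M(1) r_pos by (intro mult_mono) auto
        also have "\<dots> = B * norm s ^ (n + 2)"
          by (simp add: B_def power_mult_distrib power_divide power_add power2_eq_square)
        finally have "norm (e / (z\<^sup>2 * g i z)) \<le> B * norm s ^ (n + 2)" by simp
        with e(1) show "\<exists>D. ((\<lambda>x. ?F s x / g i x) has_field_derivative D) (at z)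
          \<and> norm D \<le> B * norm s ^ (n + 2)" by blast
      qed
      from bchoice[OF this] obtain D where D: "\<forall>z\<in>cball x1 b.
          ((\<lambda>x. ?F s x / g i x) has_field_derivative D z) (at z) \<and> norm (D z) \<le> B * norm s ^ (n + 2)"
        by blast
      show ?thesis
      proof (rule field_differentiable_bound[where S = "cball x1 b" and f' = D])
        show "((\<lambda>x. ?F s x / g i x) has_field_derivative D z) (at z within cball x1 b)"
          "norm (D z) \<le> B * norm s ^ (n + 2)" if "z \<in> cball x1 b" for z
          using D that by (blast intro: has_field_derivative_at_within)+
      qed (use x b in auto)
    qed
    have "((\<lambda>s. ?F s x1 / s ^ n / g i x1 - ?F s x / s ^ n / g i x) \<longlongrightarrow> \<kappa> x1 / g i x1 - \<kappa> x / g i x) (at 0)"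
      using x b by (intro tendsto_intros lim x1) auto
    moreover have "((\<lambda>s. ?F s x1 / s ^ n / g i x1 - ?F s x / s ^ n / g i x) \<longlongrightarrow> 0) (at 0)"
    proof (rule Lim_null_comparison)
      have "\<forall>\<^sub>F s in at 0. s \<in> ball 0 (r / (2 * M)) - {0 :: complex}"
        using r_pos M by (intro eventually_at_in_open) auto
      then show "\<forall>\<^sub>F s in at 0. norm (?F s x1 / s ^ n / g i x1 - ?F s x / s ^ n / g i x)
          \<le> B * norm s ^ 2 * norm (x1 - x)"
      proof (rule eventually_mono)
        fix s :: complex assume s: "s \<in> ball 0 (r / (2 * M)) - {0}"
        have "?F s x1 / s ^ n / g i x1 - ?F s x / s ^ n / g i x = (?F s x1 / g i x1 - ?F s x / g i x) / s ^ n"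
          by (simp add: diff_divide_distrib mult.commute)
        then have "norm (?F s x1 / s ^ n / g i x1 - ?F s x / s ^ n / g i x)
            = norm (?F s x1 / g i x1 - ?F s x / g i x) / norm s ^ n"
          by (simp only: norm_divide norm_power)
        also have "\<dots> \<le> (B * norm s ^ (n + 2) * norm (x1 - x)) / norm s ^ n"
          using s by (intro divide_right_mono key) auto
        also have "\<dots> = B * norm s ^ 2 * norm (x1 - x)"
          using s by (simp add: power_add power2_eq_square)
        finally show "norm (?F s x1 / s ^ n / g i x1 - ?F s x / s ^ n / g i x)
          \<le> B * norm s ^ 2 * norm (x1 - x)" .
      qed
      show "((\<lambda>s::complex. B * norm s ^ 2 * norm (x1 - x)) \<longlongrightarrow> 0) (at 0)"
        by (auto intro!: tendsto_eq_intros)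
    qed
    ultimately show ?thesis using LIM_unique by fastforce
  qed
  have "\<forall>\<^sub>F x in at x1 within S. x \<in> ball x1 b"
    using b by (intro filter_leD[OF at_le[OF subset_UNIV] eventually_at_in_open']) auto
  then show ?thesis by (rule eventually_mono) (use eq in auto)
qed

section \<open>Balanced points and the vanishing of the homogeneous parts\<close>

lemma balanced_rates:
  obtains B where "\<And>\<rho>. \<rho> > 0 \<Longrightarrow> \<exists>x\<in>sector d \<epsilon> \<rho>. \<forall>j. j \<noteq> 1 \<longrightarrow>
    norm (g j x) \<le> exp B * norm x powr (Re (a 2 + a 3) / 2) \<and>
    norm x powr (Re (a 2 + a 3) / 2) \<le> exp B * norm (g j x)"
proof -
  define \<beta> where "\<beta> = Re (a 2 + a 3) / 2"
  obtain B where B: "\<And>\<rho>. \<rho> > 0 \<Longrightarrow> \<exists>x\<in>sector d \<epsilon> \<rho>.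
    \<bar>ln (norm (g 2 x)) - \<beta> * ln (norm x)\<bar> \<le> B \<and> \<bar>ln (norm (g 3 x)) - \<beta> * ln (norm x)\<bar> \<le> B"
    using balanced_point[OF d_square l_nonzero \<epsilon>(1), of "a 2" "a 3"] unfolding m \<beta>_def by blast
  show ?thesis
  proof (rule that[of B], unfold \<beta>_def[symmetric])
    fix \<rho> :: real assume "\<rho> > 0"
    then obtain x where x: "x \<in> sector d \<epsilon> \<rho>"
      "\<bar>ln (norm (g 2 x)) - \<beta> * ln (norm x)\<bar> \<le> B" "\<bar>ln (norm (g 3 x)) - \<beta> * ln (norm x)\<bar> \<le> B"
      using B by blast
    have x0: "x \<noteq> 0" using x by (auto simp: sector_def)
    have "norm (g j x) \<le> exp B * norm x powr \<beta> \<and> norm x powr \<beta> \<le> exp B * norm (g j x)" if "j \<noteq> 1" for j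
    proof -
      have "\<bar>ln (norm (g j x)) - \<beta> * ln (norm x)\<bar> \<le> B"
        using x exhaust_3[of j] that by auto
      then have "exp (ln (norm (g j x))) \<le> exp (B + \<beta> * ln (norm x))"
        "exp (\<beta> * ln (norm x)) \<le> exp (B + ln (norm (g j x)))"
        unfolding exp_le_cancel_iff by linarith+
      then show ?thesis using x0 by (simp add: exp_add powr_def)
    qed
    with x(1) show "\<exists>x\<in>sector d \<epsilon> \<rho>. \<forall>j. j \<noteq> 1 \<longrightarrow>
      norm (g j x) \<le> exp B * norm x powr \<beta> \<and> norm x powr \<beta> \<le> exp B * norm (g j x)" by blast
  qed
qed

lemma limit_over_rate_const:
  assumes ord: "small_order n" "n \<ge> 1" and i: "i \<noteq> 1" and x: "x \<in> S" and x1: "x1 \<in> S"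
    and lim: "\<And>x. x \<in> S \<Longrightarrow>
      ((\<lambda>s. E i (vector [x, s * (u * g 2 x), s * (v * g 3 x)]) / s ^ n) \<longlongrightarrow> \<kappa> x) (at 0)"
  shows "\<kappa> x / g i x = \<kappa> x1 / g i x1"
proof (rule connected_local_const[OF connected_sector[OF d_nonzero r_pos \<epsilon>(2)] x x1], rule ballI)
  show "\<forall>\<^sub>F z in at x within S. \<kappa> x / g i x = \<kappa> z / g i z" if "x \<in> S" for x
    by (rule limit_over_rate_local_const[OF ord i that lim])
qed

text \<open>The limit is homogeneous of degree \<open>n\<close>, while along the balanced points all rates have the
  size of \<open>|x|^\<beta>\<close> with \<open>2\<beta> = Re (a 2 + a 3) > 0\<close>. For \<open>n = 1\<close> this is not enough, and the smallness
  comes from the tangency to the identity.\<close>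

lemma limit_eq_0:
  assumes ord: "small_order n" "n \<ge> 1" and i: "i \<noteq> 1" and x1: "x1 \<in> S"
    and lim: "\<And>x. x \<in> S \<Longrightarrow>
      ((\<lambda>s. E i (vector [x, s * (u * g 2 x), s * (v * g 3 x)]) / s ^ n) \<longlongrightarrow> \<kappa> x) (at 0)"
  shows "\<kappa> x1 = 0"
proof -
  define \<beta> where "\<beta> = Re (a 2 + a 3) / 2"
  have \<beta>: "\<beta> > 0" using residue by (simp add: \<beta>_def)
  define W where "W = max (norm u) (norm v)"
  have W: "W \<ge> 0" by (simp add: W_def le_max_iff_disj)
  obtain B where B: "\<And>\<rho>. \<rho> > 0 \<Longrightarrow> \<exists>x\<in>sector d \<epsilon> \<rho>. \<forall>j. j \<noteq> 1 \<longrightarrow>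
    norm (g j x) \<le> exp B * norm x powr \<beta> \<and> norm x powr \<beta> \<le> exp B * norm (g j x)"
    using balanced_rates unfolding \<beta>_def by blast
  \<comment> \<open>R is kept free: for n = 1 the bound to be inserted holds only for
    \<open>ynorm\<close> below |x|.\<close>
  have \<kappa>_le: "norm (\<kappa> x) \<le> A * max (norm (u * g 2 x)) (norm (v * g 3 x)) ^ n"
    if x: "x \<in> S" and "0 < R" "R \<le> r"
      and bd: "\<And>p. p \<in> N \<Longrightarrow> p $ 1 = x \<Longrightarrow> ynorm p < R \<Longrightarrow> norm (E i p) \<le> A * ynorm p ^ n" for x R A
  proof -
    obtain k where k: "((\<lambda>s. E i (vector [x, s * (u * g 2 x), s * (v * g 3 x)]) / s ^ n) \<longlongrightarrow> k) (at 0)"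
      "norm k \<le> A * max (norm (u * g 2 x)) (norm (v * g 3 x)) ^ n"
      using line_limit[OF x i \<open>0 < R\<close> \<open>R \<le> r\<close> bd] by blast
    then show ?thesis using LIM_unique[OF lim[OF x] k(1)] by simp
  qed
  define balanced where "balanced x \<longleftrightarrow> x \<in> S \<and> (\<forall>j. j \<noteq> 1 \<longrightarrow>
    norm (g j x) \<le> exp B * norm x powr \<beta> \<and> norm x powr \<beta> \<le> exp B * norm (g j x))" for x
  have max_le: "max (norm (u * g 2 x)) (norm (v * g 3 x)) \<le> W * exp B * norm x powr \<beta>"
    if "balanced x" for x
  proof -
    have "norm (u * g 2 x) \<le> W * (exp B * norm x powr \<beta>)" "norm (v * g 3 x) \<le> W * (exp B * norm x powr \<beta>)"
      unfolding norm_mult using that W by (auto simp: balanced_def W_def intro!: mult_mono)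
    then show ?thesis by (simp add: mult.assoc)
  qed
  \<comment> \<open>The factor |x|^\<beta> is the size of \<open>g i\<close> and will cancel;
    \<gamma> is the power of |x| that is left, 1 for n = 1 and \<beta> (n - 1) otherwise.\<close>
  have "\<exists>D \<gamma>. \<gamma> > 0 \<and> D \<ge> 0 \<and>
    (\<forall>x. balanced x \<longrightarrow> norm (\<kappa> x) \<le> D * norm x powr \<gamma> * norm x powr \<beta>)"
  proof (cases "n = 1")
    case True
    have "norm (\<kappa> x) \<le> (9 * C * (W * exp B)) * norm x powr 1 * norm x powr \<beta>" if x: "balanced x" for x
    proof -
      have xS: "x \<in> S" using x by (simp add: balanced_def)
      have "norm (\<kappa> x) \<le> (9 * C * norm x) * max (norm (u * g 2 x)) (norm (v * g 3 x)) ^ n"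
        using S_norm[OF xS] E_linear_small[OF _ _ i] by (intro \<kappa>_le[OF xS, of "norm x"]) (auto simp: True)
      also have "\<dots> \<le> (9 * C * norm x) * (W * exp B * norm x powr \<beta>) ^ n"
        using C_nonneg max_le[OF x] True by (intro mult_left_mono) auto
      finally show ?thesis using S_norm[OF xS] True by (simp add: mult_ac)
    qed
    then show ?thesis using C_nonneg W
      by (intro exI[of _ "9 * C * (W * exp B)"] exI[of _ 1]) auto
  next
    case False
    have "norm (\<kappa> x) \<le> (K / r ^ n * (W * exp B) ^ n) * norm x powr (\<beta> * (n - 1)) * norm x powr \<beta>"
      if x: "balanced x" for x
    proof -
      have xS: "x \<in> S" using x by (simp add: balanced_def)
      have "norm (\<kappa> x) \<le> (K / r ^ n) * max (norm (u * g 2 x)) (norm (v * g 3 x)) ^ n"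
      proof (rule \<kappa>_le[OF xS r_pos order_refl])
        fix p assume "p \<in> N"
        then have "norm (E i p) \<le> K * (ynorm p / r) ^ n" using ord(1) i by (simp add: small_order_def)
        then show "norm (E i p) \<le> K / r ^ n * ynorm p ^ n" by (simp add: power_divide)
      qed
      also have "\<dots> \<le> (K / r ^ n) * (W * exp B * norm x powr \<beta>) ^ n"
        using K_nonneg r_pos max_le[OF x] by (intro mult_left_mono power_mono) (auto simp: le_max_iff_disj)
      also have "(W * exp B * norm x powr \<beta>) ^ n = (W * exp B) ^ n * (norm x powr \<beta>) ^ n"
        by (rule power_mult_distrib)
      also have "(norm x powr \<beta>) ^ n = norm x powr (\<beta> * (n - 1)) * norm x powr \<beta>"
      proof -
        have "(norm x powr \<beta>) ^ n = norm x powr (\<beta> * n)"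
          using S_norm[OF xS] by (simp add: powr_powr flip: powr_realpow)
        also have "\<beta> * n = \<beta> * (n - 1) + \<beta>" using ord(2) by (simp add: of_nat_diff algebra_simps)
        finally show ?thesis by (simp only: powr_add)
      qed
      finally show ?thesis by (simp only: mult.assoc)
    qed
    then show ?thesis using False ord(2) K_nonneg r_pos \<beta> W
      by (intro exI[of _ "K / r ^ n * (W * exp B) ^ n"] exI[of _ "\<beta> * (n - 1)"]) auto
  qed
  then obtain D \<gamma> where D: "\<gamma> > 0" "D \<ge> 0"
    "\<And>x. balanced x \<Longrightarrow> norm (\<kappa> x) \<le> D * norm x powr \<gamma> * norm x powr \<beta>"
    by blast
  \<comment> \<open>The quotient \<kappa> / g i is constant on the sector, so it may be evaluated at
    balanced points arbitrarily close to the vertex.\<close>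
  have le: "norm (\<kappa> x1 / g i x1) \<le> D * exp B * \<rho> powr \<gamma>" if \<rho>: "0 < \<rho>" "\<rho> < r" for \<rho>
  proof -
    obtain x where x: "x \<in> sector d \<epsilon> \<rho>" "balanced x"
      using B[OF \<rho>(1)] sector_mono[of \<rho> r] \<rho>(2) unfolding balanced_def by (meson less_imp_le subsetD)
    have xS: "x \<in> S" and gi: "norm x powr \<beta> \<le> exp B * norm (g i x)"
      using x(2) i by (auto simp: balanced_def)
    have nx: "0 < norm x" "norm x < \<rho>" using x by (auto simp: sector_def)
    have "norm (\<kappa> x) \<le> D * norm x powr \<gamma> * norm x powr \<beta>" by (rule D(3)[OF x(2)])
    also have "\<dots> \<le> D * \<rho> powr \<gamma> * (exp B * norm (g i x))"
      using D(1,2) nx gi by (intro mult_mono powr_mono2) auto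
    finally have "norm (\<kappa> x) / norm (g i x) \<le> D * exp B * \<rho> powr \<gamma>"
      by (simp add: pos_divide_le_eq mult_ac)
    moreover have "\<kappa> x1 / g i x1 = \<kappa> x / g i x"
      by (rule limit_over_rate_const[OF ord i x1 xS lim])
    ultimately show ?thesis by (metis norm_divide)
  qed
  have "((\<lambda>\<rho>::real. \<rho> powr \<gamma>) \<longlongrightarrow> 0) (at_right 0)" using D(1) by real_asymp
  then have "((\<lambda>\<rho>. D * exp B * \<rho> powr \<gamma>) \<longlongrightarrow> D * exp B * 0) (at_right 0)"
    by (intro tendsto_intros)
  moreover have "\<forall>\<^sub>F \<rho> in at_right 0. norm (\<kappa> x1 / g i x1) \<le> D * exp B * \<rho> powr \<gamma>"
    unfolding eventually_at_right_field using le r_pos by (intro exI[of _ r]) auto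
  ultimately have "norm (\<kappa> x1 / g i x1) \<le> D * exp B * 0"
    by (intro tendsto_lowerbound[where F = "at_right (0::real)"]) auto
  then show ?thesis by simp
qed

lemma small_order_Suc:
  assumes ord: "small_order n" "n \<ge> 1"
  shows "small_order (Suc n)"
  unfolding small_order_def
proof (intro ballI allI impI)
  fix p and i :: 3 assume p: "p \<in> N" and i: "i \<noteq> 1"
  have x: "p $ 1 \<in> S" using p by (simp add: N_iff)
  have bd: "norm (E i p) \<le> K / r ^ n * ynorm p ^ n" if "p \<in> N" for p
  proof -
    have "norm (E i p) \<le> K * (ynorm p / r) ^ n" using ord(1) that i by (simp add: small_order_def)
    then show ?thesis by (simp add: power_divide)
  qed
  have "norm (E i p) \<le> K / r ^ n * ynorm p ^ Suc n / r"
  proof (rule norm_E_le_Schwarz[OF x i _ E_axis_eq_0[OF x i] p refl r_pos order_refl _ bd])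
    show "ynorm p < r" using p by (simp add: N_iff)
    show "((\<lambda>s. E i (vector [p $ 1, s * u, s * v]) / s ^ n) \<longlongrightarrow> 0) (at 0)" for u v
    proof -
      \<comment> \<open>With this choice the curve passes through (s u, s v) in the fibre over
        \<open>p $ 1\<close>; the rates have no zeros.\<close>
      define u' v' where "u' = u / g 2 (p $ 1)" and "v' = v / g 3 (p $ 1)"
      have "\<forall>x\<in>S. \<exists>\<kappa>. ((\<lambda>s. E i (vector [x, s * (u' * g 2 x), s * (v' * g 3 x)]) / s ^ n) \<longlongrightarrow> \<kappa>) (at 0)"
      proof
        fix x assume "x \<in> S"
        from line_limit[OF this i r_pos order_refl bd]
        show "\<exists>\<kappa>. ((\<lambda>s. E i (vector [x, s * (u' * g 2 x), s * (v' * g 3 x)]) / s ^ n) \<longlongrightarrow> \<kappa>) (at 0)"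
          by blast
      qed
      from bchoice[OF this] obtain \<kappa> where \<kappa>: "\<And>x. x \<in> S \<Longrightarrow>
          ((\<lambda>s. E i (vector [x, s * (u' * g 2 x), s * (v' * g 3 x)]) / s ^ n) \<longlongrightarrow> \<kappa> x) (at 0)"
        by blast
      have "\<kappa> (p $ 1) = 0" by (rule limit_eq_0[OF ord i x \<kappa>])
      with \<kappa>[OF x] show ?thesis by (simp add: u'_def v'_def)
    qed
  qed
  then show "norm (E i p) \<le> K * (ynorm p / r) ^ Suc n"
    by (simp add: power_divide mult_ac)
qed

lemma isotropy_trivial:
  assumes p: "p \<in> N" and i: "i \<noteq> 1"
  shows "U p $ i = p $ i"
proof -
  have ord: "small_order (Suc n)" for n
    by (induction n) (use small_order_1 small_order_Suc in auto)
  have "(\<lambda>n. K * (ynorm p / r) ^ Suc n) \<longlonglongrightarrow> K * 0"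
    using p ynorm_nonneg[of p] r_pos
    by (intro tendsto_intros LIMSEQ_Suc LIMSEQ_realpow_zero) (auto simp: N_iff)
  then have "norm (E i p) \<le> K * 0"
    by (rule LIMSEQ_le_const) (use ord p i in \<open>auto simp: small_order_def\<close>)
  then show ?thesis by (simp add: E_def)
qed

end

section \<open>Uniqueness of sectorial conjugations\<close>

lemma holo_map_on_has_derivative:
  fixes f :: "complex ^ 'n \<Rightarrow> complex ^ 'm"
  assumes "holo_map_on f S" "p \<in> S"
  obtains A :: "complex ^ 'n ^ 'm" where "(f has_derivative (\<lambda>v. A *v v)) (at p)"
proof -
  have "\<forall>i. \<exists>a::complex ^ 'n. ((\<lambda>p. f p $ i) has_derivative (\<lambda>v. \<Sum>j\<in>UNIV. a $ j * v $ j)) (at p)"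
    using assms by (auto simp: holo_map_on_def holo_fun_on_def)
  then obtain a where a: "\<And>i. ((\<lambda>p. f p $ i) has_derivative (\<lambda>v. \<Sum>j\<in>UNIV. (a i :: complex ^ 'n) $ j * v $ j)) (at p)"
    by metis
  have "(f has_derivative (\<lambda>v. (\<chi> i. a i) *v v)) (at p)"
    unfolding has_derivative_componentwise_within[of f]
  proof
    fix b :: "complex ^ 'm" assume "b \<in> Basis"
    then obtain i u where b: "b = axis i u" by (auto simp: Basis_vec_def)
    have "((\<lambda>p. f p $ i \<bullet> u) has_derivative (\<lambda>v. (\<Sum>j\<in>UNIV. a i $ j * v $ j) \<bullet> u)) (at p)"
      by (rule has_derivative_inner_left[OF a])
    then show "((\<lambda>x. f x \<bullet> b) has_derivative (\<lambda>v. ((\<chi> i. a i) *v v) \<bullet> b)) (at p)"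
      by (simp add: b inner_axis matrix_vector_mult_def)
  qed
  then show ?thesis by (rule that)
qed

lemma eval_fps_lipschitz:
  fixes c :: "complex fps"
  assumes "fps_conv_radius c > 0"
  obtains \<delta> L where "\<delta> > 0" "L \<ge> 0"
    "\<And>v w. norm v < \<delta> \<Longrightarrow> norm w < \<delta> \<Longrightarrow> norm (eval_fps c v - eval_fps c w) \<le> L * norm (v - w)"
proof -
  obtain \<delta> where \<delta>: "0 < ereal \<delta>" "ereal \<delta> < fps_conv_radius c"
    using ereal_dense2[OF assms] by auto
  have less: "ereal (norm z) < fps_conv_radius c" if "z \<in> cball 0 \<delta>" for z :: complex
  proof -
    have "ereal (norm z) \<le> ereal \<delta>" using that by simp
    then show ?thesis using \<delta>(2) by (rule le_less_trans)
  qed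
  then have sub: "cball 0 \<delta> \<subseteq> eball (0::complex) (fps_conv_radius c)"
    by (auto simp: in_eball_iff)
  have der: "(eval_fps c has_field_derivative eval_fps (fps_deriv c) z) (at z within cball 0 \<delta>)"
    if "z \<in> cball 0 \<delta>" for z
    using less[OF that] by (rule has_field_derivative_eval_fps)
  have "cball 0 \<delta> \<subseteq> eball (0::complex) (fps_conv_radius (fps_deriv c))"
    using less fps_conv_radius_deriv[of c] by (force simp: in_eball_iff intro: less_le_trans)
  then have "continuous_on (cball 0 \<delta>) (eval_fps (fps_deriv c))"
    by (intro holomorphic_on_imp_continuous_on holomorphic_on_eval_fps)
  from compact_imp_bounded[OF compact_continuous_image[OF this compact_cball]]
  obtain L where L: "L > 0" "\<And>z. z \<in> cball 0 \<delta> \<Longrightarrow> norm (eval_fps (fps_deriv c) z) \<le> L"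
    unfolding bounded_pos by blast
  have "norm (eval_fps c v - eval_fps c w) \<le> L * norm (v - w)" if "norm v < \<delta>" "norm w < \<delta>" for v w
    by (rule field_differentiable_bound[OF convex_cball der L(2)]) (use that in auto)
  then show ?thesis using that[of \<delta> L] \<delta> L by simp
qed

lemma sector_nbhd_mono: "r \<le> s \<Longrightarrow> sector_nbhd d \<epsilon> r \<subseteq> sector_nbhd d \<epsilon> s"
  using sector_mono[of r s d \<epsilon>] by (auto simp: sector_nbhd_def)

lemma norm_sector_nbhd_less:
  assumes "p \<in> sector_nbhd d \<epsilon> r"
  shows "norm p < 3 * r" "p \<noteq> 0"
proof -
  have "norm p \<le> (\<Sum>i\<in>UNIV. norm (p $ i))" unfolding norm_vec_def by (rule L2_set_le_sum) simp
  then show "norm p < 3 * r" using assms by (simp add: sum_3 sector_nbhd_def sector_def)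
  show "p \<noteq> 0" using assms by (auto simp: sector_nbhd_def sector_def)
qed

text \<open>\<Phi> is biholomorphic at radius r, but the Landau symbol speaks only of points near 0,
  which gives the tangency estimate at a smaller radius \<rho>. The push-forward equation is pulled
  back from \<Phi> p to p.\<close>

lemma sectorial_conjugationE:
  assumes "sectorial_conjugation d \<epsilon> Y Z \<Phi>"
  obtains r C \<rho> where "0 < \<rho>" "\<rho> \<le> r" "0 \<le> C" "biholo_on \<Phi> (sector_nbhd d \<epsilon> r)"
    "\<And>p. p \<in> sector_nbhd d \<epsilon> r \<Longrightarrow> \<Phi> p $ 1 = p $ 1"
    "\<And>p. p \<in> sector_nbhd d \<epsilon> r \<Longrightarrow> frechet_derivative \<Phi> (at p) (Y p) = Z (\<Phi> p)"
    "\<And>p. p \<in> sector_nbhd d \<epsilon> \<rho> \<Longrightarrow> norm (\<Phi> p - p) \<le> C * (norm p)\<^sup>2"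
proof -
  obtain r where r: "r > 0" "biholo_on \<Phi> (sector_nbhd d \<epsilon> r)" "fibered_on (sector_nbhd d \<epsilon> r) \<Phi>"
    "tangent_to_id_on (sector_nbhd d \<epsilon> r) \<Phi>"
    "\<forall>q\<in>\<Phi> ` sector_nbhd d \<epsilon> r. pushforward (sector_nbhd d \<epsilon> r) \<Phi> Y q = Z q"
    using assms unfolding sectorial_conjugation_def Let_def by blast
  from r(4) obtain C where C: "C > 0"
    "\<forall>\<^sub>F p in at 0 within sector_nbhd d \<epsilon> r. norm (norm (\<Phi> p - p)) \<le> C * norm ((norm p)\<^sup>2)"
    unfolding tangent_to_id_on_def by (elim landau_o.bigE)
  then obtain e where e: "e > 0"
    "\<And>p. p \<in> sector_nbhd d \<epsilon> r \<Longrightarrow> p \<noteq> 0 \<Longrightarrow> norm p < e \<Longrightarrow> norm (\<Phi> p - p) \<le> C * (norm p)\<^sup>2"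
    unfolding eventually_at by (auto simp: dist_norm)
  have inj: "inj_on \<Phi> (sector_nbhd d \<epsilon> r)" using r(2) by (simp add: biholo_on_def)
  show ?thesis
  proof (rule that[of "min r (e / 3)" r C])
    show "frechet_derivative \<Phi> (at p) (Y p) = Z (\<Phi> p)" if "p \<in> sector_nbhd d \<epsilon> r" for p
      using r(5) that inj by (auto simp: pushforward_def)
    show "norm (\<Phi> p - p) \<le> C * (norm p)\<^sup>2" if p: "p \<in> sector_nbhd d \<epsilon> (min r (e / 3))" for p
    proof (rule e(2))
      show "p \<in> sector_nbhd d \<epsilon> r" using p sector_nbhd_mono[of "min r (e / 3)" r d \<epsilon>] by auto
      show "p \<noteq> 0" "norm p < e" using norm_sector_nbhd_less[OF p] by auto
    qed
  qed (use r e C in \<open>auto simp: fibered_on_def\<close>)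
qed

text \<open>This makes \<phi> o \<Phi>^(-1) defined on a full sectorial neighborhood. As \<Phi> is
  fibered, x is fixed and only y has to be found, so the sector keeps its opening; y is a Brouwer
  fixed point of w + q - \<Phi> (x, w).\<close>

lemma near_identity_covers:
  fixes \<Phi> :: "complex ^ 3 \<Rightarrow> complex ^ 3"
  assumes cont: "continuous_on (sector_nbhd d \<epsilon> (4 * r)) \<Phi>" and "r > 0"
    and fib: "\<And>p. p \<in> sector_nbhd d \<epsilon> (4 * r) \<Longrightarrow> \<Phi> p $ 1 = p $ 1"
    and C: "25 * C * r \<le> 1" "C \<ge> 0"
    and bd: "\<And>p. p \<in> sector_nbhd d \<epsilon> (4 * r) \<Longrightarrow> norm (\<Phi> p - p) \<le> C * (norm p)\<^sup>2"
    and q: "q \<in> sector_nbhd d \<epsilon> r"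
  obtains p where "p \<in> sector_nbhd d \<epsilon> (4 * r)" "\<Phi> p = q"
proof -
  let ?T = "cball 0 (2 * r) \<times> cball 0 (2 * r) :: (complex \<times> complex) set"
  let ?p = "\<lambda>w::complex \<times> complex. (\<chi> i. if i = 1 then q $ 1 else if i = 2 then fst w else snd w) :: complex ^ 3"
  let ?f = "\<lambda>w. (fst w + q $ 2 - \<Phi> (?p w) $ 2, snd w + q $ 3 - \<Phi> (?p w) $ 3)"
  have q': "q $ 1 \<in> sector d \<epsilon> r" "norm (q $ 1) < r" "norm (q $ 2) < r" "norm (q $ 3) < r"
    using q by (auto simp: sector_nbhd_def sector_def)
  have pT: "?p w \<in> sector_nbhd d \<epsilon> (4 * r)" if "w \<in> ?T" for w
    using that q' \<open>r > 0\<close> sector_mono[of r "4 * r" d \<epsilon>] by (auto simp: sector_nbhd_def)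
  have normp: "norm (?p w) \<le> 5 * r" if "w \<in> ?T" for w
  proof -
    have "norm (?p w) \<le> (\<Sum>i\<in>UNIV. norm (?p w $ i))" unfolding norm_vec_def[of "?p w"]
      by (rule L2_set_le_sum) simp
    then show ?thesis using that q' by (auto simp: sum_3)
  qed
  \<comment> \<open>On the polydisc of radius 2 r over |x| < r the norm is at most 5 r, so 25 C r
    \<le> 1 keeps the displacement within r, and adding q stays within 2 r.\<close>
  have close: "norm (?p w $ j - \<Phi> (?p w) $ j) \<le> r" if w: "w \<in> ?T" for w j
  proof -
    have "norm (?p w $ j - \<Phi> (?p w) $ j) \<le> norm (\<Phi> (?p w) - ?p w)"
      using Finite_Cartesian_Product.norm_nth_le[of "\<Phi> (?p w) - ?p w" j] by (simp add: norm_minus_commute)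
    also have "\<dots> \<le> C * (norm (?p w))\<^sup>2" by (rule bd[OF pT[OF w]])
    also have "\<dots> \<le> C * (5 * r)\<^sup>2" using normp[OF w] C by (intro mult_left_mono power_mono) auto
    also have "\<dots> = (25 * C * r) * r" by (simp add: power2_eq_square)
    also have "\<dots> \<le> r" using C \<open>r > 0\<close> by (simp add: mult_left_le_one_le)
    finally show ?thesis .
  qed
  have "continuous_on ?T ?p"
  proof (rule continuous_on_vec_lambda)
    show "continuous_on ?T (\<lambda>w. if i = 1 then q $ 1 else if i = 2 then fst w else snd w)" for i :: 3
      by (cases "i = 1"; cases "i = 2") (simp_all add: continuous_on_fst continuous_on_snd)
  qed
  then have cont': "continuous_on ?T (\<lambda>w. \<Phi> (?p w))"
    by (rule continuous_on_compose2[OF cont]) (use pT in blast)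
  obtain w where w: "w \<in> ?T" "?f w = w"
  proof (rule brouwer[of ?T ?f])
    show "compact ?T" "convex ?T" "?T \<noteq> {}"
      using \<open>r > 0\<close> by (auto intro!: compact_Times convex_Times)
    show "continuous_on ?T ?f"
      by (intro continuous_intros cont')
    show "?f \<in> ?T \<rightarrow> ?T"
    proof
      fix w assume w: "w \<in> ?T"
      have "norm (q $ 2 + (fst w - \<Phi> (?p w) $ 2)) \<le> 2 * r" "norm (q $ 3 + (snd w - \<Phi> (?p w) $ 3)) \<le> 2 * r"
        using close[OF w, of 2] close[OF w, of 3] q' by (auto intro!: norm_triangle_le)
      then show "?f w \<in> ?T" by (simp add: algebra_simps)
    qed
  qed
  have "\<Phi> (?p w) = q"
    using w(2) fib[OF pT[OF w(1)]] by (auto simp: vec_eq_iff forall_3 prod_eq_iff)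
  with pT[OF w(1)] show ?thesis by (rule that)
qed

text \<open>The direction enters only through d^2 = - l^2, so that i l and - i l are covered at
  once.\<close>

theorem sectorial_conjugation_unique:
  assumes d: "d\<^sup>2 = - l\<^sup>2" "l \<noteq> 0" and \<epsilon>: "0 < \<epsilon>" "\<epsilon> < pi / 2" and res: "Re (a1 + a2) > 0"
    and c: "fps_nth c1 0 = 0" "fps_nth c2 0 = 0" "fps_conv_radius c1 > 0" "fps_conv_radius c2 > 0"
    and \<Phi>: "sectorial_conjugation d \<epsilon> Y (normal_form l a1 a2 c1 c2) \<Phi>"
    and \<phi>: "sectorial_conjugation d \<epsilon> Y (normal_form l a1 a2 c1 c2) \<phi>"
  shows "germ_eq d \<epsilon> \<phi> \<Phi>"
proof -
  define Z where "Z = normal_form l a1 a2 c1 c2"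
  obtain r1 C1 \<rho>1 where 1: "0 < \<rho>1" "\<rho>1 \<le> r1" "0 \<le> C1" "biholo_on \<Phi> (sector_nbhd d \<epsilon> r1)"
    "\<And>p. p \<in> sector_nbhd d \<epsilon> r1 \<Longrightarrow> \<Phi> p $ 1 = p $ 1"
    "\<And>p. p \<in> sector_nbhd d \<epsilon> r1 \<Longrightarrow> frechet_derivative \<Phi> (at p) (Y p) = Z (\<Phi> p)"
    "\<And>p. p \<in> sector_nbhd d \<epsilon> \<rho>1 \<Longrightarrow> norm (\<Phi> p - p) \<le> C1 * (norm p)\<^sup>2"
    using sectorial_conjugationE[OF \<Phi>] unfolding Z_def by metis
  obtain r2 C2 \<rho>2 where 2: "0 < \<rho>2" "\<rho>2 \<le> r2" "0 \<le> C2" "biholo_on \<phi> (sector_nbhd d \<epsilon> r2)"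
    "\<And>p. p \<in> sector_nbhd d \<epsilon> r2 \<Longrightarrow> \<phi> p $ 1 = p $ 1"
    "\<And>p. p \<in> sector_nbhd d \<epsilon> r2 \<Longrightarrow> frechet_derivative \<phi> (at p) (Y p) = Z (\<phi> p)"
    "\<And>p. p \<in> sector_nbhd d \<epsilon> \<rho>2 \<Longrightarrow> norm (\<phi> p - p) \<le> C2 * (norm p)\<^sup>2"
    using sectorial_conjugationE[OF \<phi>] unfolding Z_def by metis
  obtain \<delta>1 L1 where L1: "\<delta>1 > 0" "L1 \<ge> 0"
    "\<And>v w. norm v < \<delta>1 \<Longrightarrow> norm w < \<delta>1 \<Longrightarrow> norm (eval_fps c1 v - eval_fps c1 w) \<le> L1 * norm (v - w)"
    using eval_fps_lipschitz[OF c(3)] by metis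
  obtain \<delta>2 L2 where L2: "\<delta>2 > 0" "L2 \<ge> 0"
    "\<And>v w. norm v < \<delta>2 \<Longrightarrow> norm w < \<delta>2 \<Longrightarrow> norm (eval_fps c2 v - eval_fps c2 w) \<le> L2 * norm (v - w)"
    using eval_fps_lipschitz[OF c(4)] by metis
  define C where "C = C1 + C2"
  define \<delta> where "\<delta> = min \<delta>1 \<delta>2"
  \<comment> \<open>The first two entries put the neighborhood of radius 4 r inside both tangency
    estimates. The third serves the covering and the comparison of \<Psi> q with q. The last two
    bound products of two coordinates, each at most 6 r, by (6 r)^2 \<le> 6 r < \<delta>.\<close>
  define r where "r = Min {\<rho>1 / 4, \<rho>2 / 4, 1 / (25 * (C + 1)), 1 / 6, \<delta> / 7}"
  have C: "C \<ge> 0" "C1 \<le> C" using 1 2 by (auto simp: C_def)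
  have \<delta>: "\<delta> > 0" using L1 L2 by (simp add: \<delta>_def)
  have r: "r > 0" "4 * r \<le> \<rho>1" "4 * r \<le> \<rho>2" "25 * (C + 1) * r \<le> 1" "6 * r \<le> 1" "6 * r < \<delta>"
  proof -
    show r0: "r > 0" using 1 2 C \<delta> by (auto simp: r_def)
    have "r \<le> \<rho>1 / 4" "r \<le> \<rho>2 / 4" "r \<le> 1 / (25 * (C + 1))" "r \<le> 1 / 6" "r \<le> \<delta> / 7"
      unfolding r_def by (intro Min_le; simp)+
    then show "4 * r \<le> \<rho>1" "4 * r \<le> \<rho>2" "25 * (C + 1) * r \<le> 1" "6 * r \<le> 1" "6 * r < \<delta>"
      using r0 C \<delta> by (auto simp: field_simps)
  qed
  have Cr: "25 * C * r \<le> 1" "25 * C1 * r \<le> 1"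
  proof -
    have "25 * C * r \<le> 25 * (C + 1) * r" using r(1) by (intro mult_right_mono) auto
    with r(4) show *: "25 * C * r \<le> 1" by simp
    have "25 * C1 * r \<le> 25 * C * r" using r(1) C by (intro mult_right_mono) auto
    with * show "25 * C1 * r \<le> 1" by simp
  qed
  let ?N = "\<lambda>r. sector_nbhd d \<epsilon> r"
  have sub: "?N (4 * r) \<subseteq> ?N \<rho>1" "?N (4 * r) \<subseteq> ?N \<rho>2" "?N (4 * r) \<subseteq> ?N r1" "?N (4 * r) \<subseteq> ?N r2"
    using r(2,3) 1(2) 2(2) by (intro sector_nbhd_mono; linarith)+
  define \<Psi> where "\<Psi> = inv_into (?N r1) \<Phi>"
  define U where "U = \<phi> \<circ> \<Psi>"
  have inj: "inj_on \<Phi> (?N r1)" and open1: "open (?N r1)" and open\<Phi>: "open (\<Phi> ` ?N r1)"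
    and holo\<Phi>: "holo_map_on \<Phi> (?N r1)" and holo\<Psi>: "holo_map_on \<Psi> (\<Phi> ` ?N r1)"
    using 1(4) by (auto simp: biholo_on_def \<Psi>_def)
  have holo\<phi>: "holo_map_on \<phi> (?N r2)" using 2(4) by (auto simp: biholo_on_def)
  have cont\<Phi>: "continuous_on (?N (4 * r)) \<Phi>"
    using holo_map_on_has_derivative[OF holo\<Phi>] sub(3)
    by (intro continuous_at_imp_continuous_on) (metis has_derivative_continuous subsetD)
  have \<Psi>: "\<Psi> q \<in> ?N (4 * r)" "\<Phi> (\<Psi> q) = q" "\<Psi> q $ 1 = q $ 1" if q: "q \<in> ?N r" for q
  proof -
    obtain p where p: "p \<in> ?N (4 * r)" "\<Phi> p = q"
      by (rule near_identity_covers[OF cont\<Phi> r(1) _ Cr(2) 1(3) _ q]) (use 1 sub in auto)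
    then have "\<Psi> q = p" unfolding \<Psi>_def using inj sub(3) by (auto simp: inv_into_f_f)
    with p show "\<Psi> q \<in> ?N (4 * r)" "\<Phi> (\<Psi> q) = q" "\<Psi> q $ 1 = q $ 1" using 1(5) sub(3) by auto
  qed
  have U1: "U q $ 1 = q $ 1" if "q \<in> ?N r" for q
    using \<Psi>[OF that] 2(5) sub(4) by (auto simp: U_def)
  have tangent: "norm (U q - q) \<le> 4 * C * (norm q)\<^sup>2" if q: "q \<in> ?N r" for q
  proof -
    let ?p = "\<Psi> q"
    have p: "?p \<in> ?N \<rho>1" "?p \<in> ?N \<rho>2" using \<Psi>(1)[OF q] sub by auto
    \<comment> \<open>Half of |p| is absorbed: |p| \<le> |q| + |p| / 2 gives |p| \<le> 2 |q|, and
      the tangency constant of U becomes 4 C.\<close>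
    have "C * norm ?p \<le> C * (12 * r)" using norm_sector_nbhd_less(1)[OF \<Psi>(1)[OF q]] C(1)
      by (intro mult_left_mono) auto
    also have "\<dots> \<le> 1 / 2" using Cr by simp
    finally have "C * norm ?p * norm ?p \<le> 1 / 2 * norm ?p" by (rule mult_right_mono) simp
    moreover have "norm (\<Phi> ?p - ?p) \<le> C * (norm ?p)\<^sup>2"
      using 1(7)[OF p(1)] C by (meson mult_right_mono order_trans zero_le_power2)
    moreover have "norm ?p \<le> norm (\<Phi> ?p) + norm (\<Phi> ?p - ?p)"
      by (metis norm_minus_commute norm_triangle_sub)
    ultimately have np: "norm ?p \<le> 2 * norm q" by (simp add: \<Psi>(2)[OF q] power2_eq_square)
    have "U q - q = (\<phi> ?p - ?p) - (\<Phi> ?p - ?p)" by (simp add: U_def \<Psi>(2)[OF q])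
    then have "norm (U q - q) \<le> norm (\<phi> ?p - ?p) + norm (\<Phi> ?p - ?p)"
      by (metis norm_triangle_ineq4)
    also have "\<dots> \<le> C2 * (norm ?p)\<^sup>2 + C1 * (norm ?p)\<^sup>2" by (intro add_mono 1(7) 2(7) p)
    also have "\<dots> = C * (norm ?p)\<^sup>2" by (simp add: C_def algebra_simps)
    also have "\<dots> \<le> C * (2 * norm q)\<^sup>2" using np C by (intro mult_left_mono power_mono) auto
    finally show ?thesis by (simp add: power_mult_distrib)
  qed
  define m a :: "3 \<Rightarrow> complex" where "m = (\<lambda>j. if j = 2 then - l else l)" and "a = (\<lambda>j. if j = 2 then a1 else a2)"
  \<comment> \<open>Index 1 receives the function of index 3, so that the Lipschitz bound and the
    value at 0 hold for every index.\<close>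
  define cc where "cc = (\<lambda>j::3. if j = 2 then eval_fps c1 else eval_fps c2)"
  have Z1: "Z p $ 1 = (p $ 1)\<^sup>2"
    and Zj: "j \<noteq> 1 \<Longrightarrow> Z p $ j = (m j + a j * p $ 1 + cc j (p $ 2 * p $ 3)) * p $ j" for p j
    using exhaust_3[of j] by (auto simp: Z_def normal_form_def m_def a_def cc_def)
  have invariance: "\<exists>A::complex ^ 3 ^ 3. (U has_derivative (\<lambda>v. A *v v)) (at q) \<and> A *v Z q = Z (U q)"
    if q: "q \<in> ?N r" for q
  proof -
    let ?p = "\<Psi> q"
    have p: "?p \<in> ?N r1" "?p \<in> ?N r2" and q\<Phi>: "q \<in> \<Phi> ` ?N r1" using \<Psi>[OF q] sub by (auto intro: rev_image_eqI)
    obtain A\<Phi> :: "complex ^ 3 ^ 3" where A\<Phi>: "(\<Phi> has_derivative (\<lambda>v. A\<Phi> *v v)) (at ?p)"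
      using holo_map_on_has_derivative[OF holo\<Phi> p(1)] .
    obtain A\<phi> :: "complex ^ 3 ^ 3" where A\<phi>: "(\<phi> has_derivative (\<lambda>v. A\<phi> *v v)) (at ?p)"
      using holo_map_on_has_derivative[OF holo\<phi> p(2)] .
    obtain A\<Psi> :: "complex ^ 3 ^ 3" where A\<Psi>: "(\<Psi> has_derivative (\<lambda>v. A\<Psi> *v v)) (at q)"
      using holo_map_on_has_derivative[OF holo\<Psi> q\<Phi>] .
    \<comment> \<open>Differentiating \<Psi> o \<Phi> = id inverts the Jacobian of \<Phi>: the
      derivative of \<Psi> carries Z back to Y, and that of \<phi> carries Y to Z.\<close>
    have "((\<lambda>p. \<Psi> (\<Phi> p)) has_derivative (\<lambda>v. A\<Psi> *v (A\<Phi> *v v))) (at ?p)"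
      by (rule has_derivative_compose[OF A\<Phi>]) (use A\<Psi> \<Psi>(2)[OF q] in simp)
    then have "((\<lambda>p. p) has_derivative (\<lambda>v. A\<Psi> *v (A\<Phi> *v v))) (at ?p)"
      by (rule has_derivative_transform_within_open[OF _ open1 p(1)]) (use inj in \<open>simp add: \<Psi>_def\<close>)
    then have id: "(\<lambda>v. A\<Psi> *v (A\<Phi> *v v)) = (\<lambda>v. v)"
      using has_derivative_unique[OF _ has_derivative_ident] by blast
    have "A\<Phi> *v Y ?p = Z q"
      using 1(6)[OF p(1)] frechet_derivative_at[OF A\<Phi>] \<Psi>(2)[OF q] by metis
    then have "A\<Psi> *v Z q = Y ?p" using fun_cong[OF id, of "Y ?p"] by simp
    moreover have "A\<phi> *v Y ?p = Z (\<phi> ?p)"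
      using 2(6)[OF p(2)] frechet_derivative_at[OF A\<phi>] by metis
    ultimately have "(A\<phi> ** A\<Psi>) *v Z q = Z (U q)"
      by (simp add: U_def flip: matrix_vector_mul_assoc)
    moreover have "(U has_derivative (\<lambda>v. (A\<phi> ** A\<Psi>) *v v)) (at q)"
      unfolding U_def o_def matrix_vector_mul_assoc[symmetric]
      by (rule has_derivative_compose[OF A\<Psi> A\<phi>])
    ultimately show ?thesis by blast
  qed
  have small: "norm (q $ 2 * q $ 3) < \<delta>" "norm (U q $ 2 * U q $ 3) < \<delta>" if q: "q \<in> ?N r" for q
  proof -
    have prod: "norm (x * y) < \<delta>" if "norm x \<le> 6 * r" "norm y \<le> 6 * r" for x y :: complex
    proof -
      have "norm (x * y) \<le> (6 * r) * (6 * r)" unfolding norm_mult using that r(1) by (intro mult_mono) auto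
      also have "\<dots> \<le> 6 * r" using r by (intro mult_left_le) auto
      finally show ?thesis using r by simp
    qed
    have nq: "norm q < 3 * r" by (rule norm_sector_nbhd_less[OF q])
    have "norm (U q) \<le> norm q + norm (U q - q)" by (metis norm_triangle_sub)
    also have "\<dots> \<le> norm q + 4 * C * (norm q)\<^sup>2" using tangent[OF q] by simp
    also have "\<dots> \<le> 3 * r + 4 * C * (3 * r)\<^sup>2"
      using nq C by (intro add_mono mult_left_mono power_mono) auto
    also have "\<dots> = 3 * r + (36 * C * r) * r" by (simp add: power2_eq_square)
    also have "\<dots> \<le> 3 * r + 2 * r" using Cr r by (intro add_mono mult_right_mono) auto
    finally have nU: "norm (U q) \<le> 6 * r" using r by simp
    have "norm (q $ j) \<le> 6 * r" "norm (U q $ j) \<le> 6 * r" for j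
      using Finite_Cartesian_Product.norm_nth_le[of q j] Finite_Cartesian_Product.norm_nth_le[of "U q" j]
        nq nU r(1) by linarith+
    then show "norm (q $ 2 * q $ 3) < \<delta>" "norm (U q $ 2 * U q $ 3) < \<delta>" by (auto intro: prod)
  qed
  interpret sectorial_isotropy d l \<epsilon> r "4 * C" "L1 + L2" \<delta> m a cc U
  proof
    show "d\<^sup>2 = - l\<^sup>2" "l \<noteq> 0" "0 < \<epsilon>" "\<epsilon> < pi / 2" "0 < r" by fact+
    show "0 \<le> 4 * C" "0 \<le> L1 + L2" using C L1 L2 by auto
    show "m 2 = - l" "m 3 = l" "Re (a 2 + a 3) > 0" using res by (auto simp: m_def a_def)
    show "norm (U p - p) \<le> 4 * C * (norm p)\<^sup>2" if "p \<in> ?N r" for p by (rule tangent[OF that])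
    show "\<exists>A::complex ^ 3. ((\<lambda>p. U p $ i) has_derivative (\<lambda>v. \<Sum>j\<in>UNIV. A $ j * v $ j)) (at p) \<and>
        A $ 1 * (p $ 1)\<^sup>2 + (\<Sum>j\<in>{2,3}. A $ j * ((m j + a j * p $ 1 + cc j (p $ 2 * p $ 3)) * p $ j)) =
        (m i + a i * p $ 1 + cc i (U p $ 2 * U p $ 3)) * U p $ i" if p: "p \<in> ?N r" and i: "i \<noteq> 1" for p i
    proof -
      obtain A :: "complex ^ 3 ^ 3" where A: "(U has_derivative (\<lambda>v. A *v v)) (at p)" "A *v Z p = Z (U p)"
        using invariance[OF p] by blast
      have "((\<lambda>p. U p $ i) has_derivative (\<lambda>v. (A *v v) $ i)) (at p)"
        by (rule bounded_linear.has_derivative[OF bounded_linear_vec_nth A(1)])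
      then have "((\<lambda>p. U p $ i) has_derivative (\<lambda>v. \<Sum>j\<in>UNIV. A $ i $ j * v $ j)) (at p)"
        by (simp add: matrix_vector_mult_def)
      moreover have "(A *v Z p) $ i = (m i + a i * p $ 1 + cc i (U p $ 2 * U p $ 3)) * U p $ i"
        unfolding A(2) Zj[OF i] U1[OF p] ..
      ultimately show ?thesis
        by (intro exI[of _ "A $ i"]) (simp add: matrix_vector_mult_def sum_3 Z1 Zj add.assoc)
    qed
    show "norm (cc i v - cc i w) \<le> (L1 + L2) * norm (v - w)" if "norm v < \<delta>" "norm w < \<delta>" for i v w
    proof -
      have "norm (cc i v - cc i w) \<le> L1 * norm (v - w) \<or> norm (cc i v - cc i w) \<le> L2 * norm (v - w)"
        using L1(3)[of v w] L2(3)[of v w] that by (auto simp: cc_def \<delta>_def)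
      moreover have "L1 * norm (v - w) \<ge> 0" "L2 * norm (v - w) \<ge> 0" using L1 L2 by auto
      ultimately show ?thesis unfolding distrib_right by linarith
    qed
    show "cc i 0 = 0" for i using c by (simp add: cc_def eval_fps_at_0)
    show "norm (p $ 2 * p $ 3) < \<delta> \<and> norm (U p $ 2 * U p $ 3) < \<delta>" if "p \<in> ?N r" for p
      using small[OF that] by blast
  qed
  have U_id: "U q = q" if q: "q \<in> ?N r" for q
    using isotropy_trivial[OF q] U1[OF q] by (metis vec_eq_iff)
  \<comment> \<open>From radius r / 4, a displacement of each coordinate by at most r / 25 leaves
    \<Phi> p in the neighborhood where U is the identity; there \<phi> p = U (\<Phi> p) = \<Phi>
    p.\<close>
  have "\<phi> p = \<Phi> p" if p: "p \<in> ?N (r / 4)" for p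
  proof -
    have p4: "p \<in> ?N (4 * r)" using p sector_nbhd_mono[of "r / 4" "4 * r" d \<epsilon>] r(1) by auto
    have "norm (\<Phi> p - p) \<le> C1 * (norm p)\<^sup>2" using 1(7) p4 sub(1) by blast
    also have "\<dots> \<le> C1 * r\<^sup>2"
      using norm_sector_nbhd_less(1)[OF p] 1(3) r(1) by (intro mult_left_mono power_mono) auto
    also have "\<dots> \<le> r / 25" using Cr(2) r(1) mult_right_mono[of "25 * C1 * r" 1 r] by (simp add: power2_eq_square)
    finally have "norm (\<Phi> p $ j - p $ j) \<le> r / 25" for j
      using Finite_Cartesian_Product.norm_nth_le[of "\<Phi> p - p" j] by simp
    then have near: "norm (\<Phi> p $ j) \<le> norm (p $ j) + r / 25" for j
      using norm_triangle_sub[of "\<Phi> p $ j" "p $ j"] by (metis add_left_mono order_trans)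
    have p': "norm (p $ 2) < r / 4" "norm (p $ 3) < r / 4" "p $ 1 \<in> sector d \<epsilon> (r / 4)"
      using p by (auto simp: sector_nbhd_def)
    have "norm (\<Phi> p $ 2) < r" "norm (\<Phi> p $ 3) < r"
      using near[of 2] near[of 3] p'(1,2) r(1) by linarith+
    moreover have "\<Phi> p $ 1 = p $ 1" using 1(5) p4 sub(3) by blast
    then have "\<Phi> p $ 1 \<in> sector d \<epsilon> r"
      using p'(3) sector_mono[of "r / 4" r d \<epsilon>] r(1) by auto
    ultimately have "\<Phi> p \<in> ?N r" by (simp add: sector_nbhd_def)
    then have "\<phi> (\<Psi> (\<Phi> p)) = \<Phi> p" using U_id unfolding U_def o_def by blast
    moreover have "\<Psi> (\<Phi> p) = p"
      unfolding \<Psi>_def using inj p4 sub(3) by (blast intro: inv_into_f_f)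
    ultimately show ?thesis by simp
  qed
  then show ?thesis using r(1) by (auto simp: germ_eq_def intro!: exI[of _ "r / 4"])
qed

theorem proposition1p13:
  fixes l a1 a2 :: complex and F1 F2 h1 h2 :: mfps and c1 c2 :: "complex fps"
    and Y Ynorm \<Phi>p \<Phi>m \<phi>p \<phi>m :: "complex ^ 3 \<Rightarrow> complex ^ 3" and \<epsilon> :: real
  defines "Y \<equiv> drsn_field l F1 F2"
    and "Ynorm \<equiv> normal_form l a1 a2 c1 c2"
  assumes "diagonal_drsn l F1 F2"
    and "strictly_nondegenerate l F1 F2"
    and "div_integrable Y"
    and "formal_normalization l F1 F2 a1 a2 c1 c2 h1 h2"
    and "0 < \<epsilon>" and "\<epsilon> < pi / 2"
    and "sectorial_normalizing_map (\<i> * l) \<epsilon> Y Ynorm h1 h2 \<Phi>p"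
    and "sectorial_normalizing_map (- \<i> * l) \<epsilon> Y Ynorm h1 h2 \<Phi>m"
    and "sectorial_conjugation (\<i> * l) \<epsilon> Y Ynorm \<phi>p"
    and "sectorial_conjugation (- \<i> * l) \<epsilon> Y Ynorm \<phi>m"
  shows "germ_eq (\<i> * l) \<epsilon> \<phi>p \<Phi>p \<and> germ_eq (- \<i> * l) \<epsilon> \<phi>m \<Phi>m"
proof -
  have l: "l \<noteq> 0" using assms by (simp add: diagonal_drsn_def)
  have res: "Re (a1 + a2) > 0" and c: "fps_nth c1 0 = 0" "fps_nth c2 0 = 0"
      "fps_conv_radius c1 > 0" "fps_conv_radius c2 > 0"
    using assms(4,6) by (auto simp: formal_normalization_def strictly_nondegenerate_def)
  have unique: "germ_eq d \<epsilon> \<phi> \<Phi>" if "d\<^sup>2 = - l\<^sup>2" "sectorial_normalizing_map d \<epsilon> Y Ynorm h1 h2 \<Phi>"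
    "sectorial_conjugation d \<epsilon> Y Ynorm \<phi>" for d \<phi> \<Phi>
    using that sectorial_conjugation_unique[OF that(1) l assms(7,8) res c, of Y \<Phi> \<phi>]
    by (simp add: sectorial_normalizing_map_def Ynorm_def)
  show ?thesis
    using assms by (intro conjI unique) (simp_all add: power_mult_distrib)
qed

end
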